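(* If $X=(X,d,\mu)$ is a class A space then $\mathscr{K}(X)=\mathscr{G}(X)$, where $$\mathscr{G}(X)=\{T\in\mathscr{E}(X):\ \lim_{x\to\infty}\|\mathbf{1}_{B_x(r)}T\|=0\ \text{for all } r>0\}.$$
   Context: Let $(X,d)$ be a non-compact proper metric space (closed balls $B_x(r)=\{y:d(x,y)\le r\}$ compact) and $\mu$ a Radon measure on $X$ with support $X$, with $\mu(B_x(r))>0$ and $\sup_x\mu(B_x(r))<\infty$ for all $r>0$. $L^2(X)=L^2(X,\mu)$; $\mathscr{K}(X)$ the compact operators on it; $\mathbf{1}_A$ the multiplication operator by the characteristic function of a measurable set $A$. A kernel $k$ on $X\times X$ is controlled if $k(x,y)=0$ whenever $d(x,y)>r$ for some $r$. $\mathscr{E}(X)$ is the norm closure of the operators $(Op(k)f)(x)=\int k(x,y)f(y)d\mu(y)$ with $k$ bounded, uniformly continuous and controlled. $\lim_{x\to\infty}$ denotes the limit as $x$ leaves every compact set. Property A: for every $\varepsilon,r>0$ there is a Borel map $\phi:X\to L^2(X)$ with $\|\phi(x)\|=1$, $\mathrm{supp}\,\phi(x)\subset B_x(s)$ for some $s$ independent of $x$, and $\|\phi(x)-\phi(y)\|<\varepsilon$ if $d(x,y)<r$. A class A space is such an $(X,d,\mu)$ which moreover satisfies $\inf_x\mu(B_x(1/2))>0$ and has Property A. *)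

theory Defs
  imports "HOL-Analysis.Analysis"
begin

text \<open>Concrete model of L^2(X,mu) (complex scalars): square-integrable Borel functions,
  identified up to the L^2 seminorm. Operators are maps on functions, considered
  only on L^2 functions and only modulo null functions.\<close>

definition is_L2 :: "'a measure \<Rightarrow> ('a \<Rightarrow> complex) \<Rightarrow> bool" where
  "is_L2 M f \<longleftrightarrow> f \<in> borel_measurable M \<and> integrable M (\<lambda>x. (cmod (f x))\<^sup>2)"

definition l2norm :: "'a measure \<Rightarrow> ('a \<Rightarrow> complex) \<Rightarrow> real" where
  "l2norm M f = sqrt (integral\<^sup>L M (\<lambda>x. (cmod (f x))\<^sup>2))"

definition bounded_op :: "'a measure \<Rightarrow> (('a \<Rightarrow> complex) \<Rightarrow> ('a \<Rightarrow> complex)) \<Rightarrow> bool" where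
  "bounded_op M T \<longleftrightarrow>
     (\<forall>f. is_L2 M f \<longrightarrow> is_L2 M (T f)) \<and>
     (\<forall>f g c. is_L2 M f \<longrightarrow> is_L2 M g \<longrightarrow>
        l2norm M (\<lambda>x. T (\<lambda>y. f y + c * g y) x - T f x - c * T g x) = 0) \<and>
     (\<exists>C. \<forall>f. is_L2 M f \<longrightarrow> l2norm M (T f) \<le> C * l2norm M f)"

definition opnorm :: "'a measure \<Rightarrow> (('a \<Rightarrow> complex) \<Rightarrow> ('a \<Rightarrow> complex)) \<Rightarrow> real" where
  "opnorm M T = Sup {l2norm M (T f) | f. is_L2 M f \<and> l2norm M f \<le> 1}"

text \<open>Compact operator: bounded, and the image of the unit ball is relatively compact,
  i.e. (L^2 being complete) totally bounded.\<close>
definition compact_op :: "'a measure \<Rightarrow> (('a \<Rightarrow> complex) \<Rightarrow> ('a \<Rightarrow> complex)) \<Rightarrow> bool" where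
  "compact_op M T \<longleftrightarrow> bounded_op M T \<and>
     (\<forall>e>0. \<exists>F. finite F \<and> (\<forall>g\<in>F. is_L2 M g) \<and>
        (\<forall>f. is_L2 M f \<and> l2norm M f \<le> 1 \<longrightarrow> (\<exists>g\<in>F. l2norm M (\<lambda>x. T f x - g x) < e)))"

definition Op :: "'a measure \<Rightarrow> ('a \<Rightarrow> 'a \<Rightarrow> complex) \<Rightarrow> ('a \<Rightarrow> complex) \<Rightarrow> ('a \<Rightarrow> complex)" where
  "Op M k f = (\<lambda>x. integral\<^sup>L M (\<lambda>y. k x y * f y))"

definition good_kernel :: "('a::metric_space \<Rightarrow> 'a \<Rightarrow> complex) \<Rightarrow> bool" where
  "good_kernel k \<longleftrightarrow> (\<exists>B. \<forall>x y. cmod (k x y) \<le> B) \<and>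
     uniformly_continuous_on UNIV (\<lambda>p. k (fst p) (snd p)) \<and>
     (\<exists>r. \<forall>x y. dist x y > r \<longrightarrow> k x y = 0)"

definition in_E :: "'a::metric_space measure \<Rightarrow> (('a \<Rightarrow> complex) \<Rightarrow> ('a \<Rightarrow> complex)) \<Rightarrow> bool" where
  "in_E M T \<longleftrightarrow> bounded_op M T \<and>
     (\<forall>e>0. \<exists>k. good_kernel k \<and> bounded_op M (Op M k) \<and>
        opnorm M (\<lambda>f x. T f x - Op M k f x) < e)"

definition in_G :: "'a::metric_space measure \<Rightarrow> (('a \<Rightarrow> complex) \<Rightarrow> ('a \<Rightarrow> complex)) \<Rightarrow> bool" where
  "in_G M T \<longleftrightarrow> in_E M T \<and>
     (\<forall>r>0. \<forall>e>0. \<exists>K. compact K \<and>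
        (\<forall>x. x \<notin> K \<longrightarrow> opnorm M (\<lambda>f y. indicator (cball x r) y * T f y) < e))"

definition radon_measure :: "'a::metric_space measure \<Rightarrow> bool" where
  "radon_measure M \<longleftrightarrow> sets M = sets borel \<and>
     (\<forall>K. compact K \<longrightarrow> emeasure M K < \<infinity>) \<and>
     (\<forall>A\<in>sets borel. emeasure M A = (INF U\<in>{U. open U \<and> A \<subseteq> U}. emeasure M U)) \<and>
     (\<forall>U. open U \<longrightarrow> emeasure M U = (SUP K\<in>{K. compact K \<and> K \<subseteq> U}. emeasure M K))"

definition property_A :: "'a::metric_space measure \<Rightarrow> bool" where
  "property_A M \<longleftrightarrow> (\<forall>e>0. \<forall>r>0. \<exists>(\<phi>::'a \<Rightarrow> 'a \<Rightarrow> complex) s.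
     (\<forall>x. is_L2 M (\<phi> x) \<and> l2norm M (\<phi> x) = 1 \<and> (AE y in M. dist x y > s \<longrightarrow> \<phi> x y = 0)) \<and>
     (\<forall>g. is_L2 M g \<longrightarrow> (\<lambda>x. l2norm M (\<lambda>y. \<phi> x y - g y)) \<in> borel_measurable borel) \<and>
     (\<forall>x y. dist x y < r \<longrightarrow> l2norm M (\<lambda>z. \<phi> x z - \<phi> y z) < e))"

definition class_A :: "'a::metric_space measure \<Rightarrow> bool" where
  "class_A M \<longleftrightarrow>
     (\<forall>x::'a. \<forall>r. compact (cball x r)) \<and> \<not> compact (UNIV :: 'a set) \<and>
     radon_measure M \<and>
     (\<forall>U::'a set. open U \<and> U \<noteq> {} \<longrightarrow> emeasure M U > 0) \<and>
     (\<forall>x r. r > 0 \<longrightarrow> emeasure M (cball x r) > 0) \<and>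
     (\<forall>r>0. \<exists>C::real. \<forall>x. emeasure M (cball x r) \<le> ennreal C) \<and>
     (\<exists>c::real. c > 0 \<and> (\<forall>x. emeasure M (cball x (1/2)) \<ge> ennreal c)) \<and>
     property_A M"

end

theory Submission
  imports Defs
begin

text \<open>A compact operator is small on the orthogonal complement of finitely many vectors, hence a
  norm limit of finite-rank operators; since Lipschitz functions of bounded support are dense in
  \<open>L\<^sup>2\<close>, the finite-rank operators may be taken with good kernels, and \<open>1\<^bsub>B\<^esub> T\<close> vanishes at infinity
  because the image of the unit ball is totally bounded.

  Conversely, let \<open>S\<close> be a good kernel operator within \<open>e\<close> of \<open>T\<close>. Property A gives unit vectors
  \<open>\<Phi> x\<close> that vary slowly with \<open>x\<close>, so that \<open>l2norm (S f)\<close> is controlled by the norms of \<open>S\<close> on the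
  localised functions \<open>\<lambda>y. \<Phi> y z * f y\<close>. If \<open>f\<close> lives far away, so do these pieces; \<open>S\<close> has finite
  propagation and \<open>1\<^bsub>B\<^esub> T\<close> is small there, hence \<open>S\<close> is small on functions supported outside a large
  ball. The rest of \<open>S\<close> has a uniformly continuous kernel of bounded support and is compact.\<close>

subsection \<open>Square-integrable functions\<close>

text \<open>The vanishing condition constrains only the output of \<open>T\<close> and says nothing
  directly about \<open>T\<close> on functions living far away. Finite propagation bridges the two:
  if \<open>h\<close> lives in a ball about \<open>z\<close>, then \<open>S h\<close> lives in a
  slightly larger ball, and multiplying it by the indicator of that ball loses nothing.
  \<open>T\<close> itself need not have finite propagation, so the argument is run for
  \<open>S\<close> and the error \<open>e\<close> is carried along. Since the weights
  \<open>\<Phi> x\<close> have unit norm, the squares of the localised norms recombine without any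
  multiplicity factor; the price is a commutator error, small by slow variation. The order of
  choices matters: \<open>e\<close>, then \<open>S\<close> with its propagation \<open>r\<close> and
  kernel bound \<open>B\<close>, then the tolerance \<open>\<delta>\<close>, then the support radius
  \<open>s\<close> from Property A, and only then the compact set \<open>K\<close> for balls of
  radius \<open>s + r\<close>. This is not circular because vanishing is available for every radius.
  Functions are never identified modulo null sets, so algebraic laws for operators hold only almost
  everywhere.\<close>

lemma is_L2_measurable [measurable_dest]: "is_L2 M f \<Longrightarrow> f \<in> borel_measurable M"
  by (simp add: is_L2_def)

text \<open>Tonelli needs no integrability for nonnegative integrals. In this form the localised
  functions are seen to be in \<open>L\<^sup>2\<close> for almost every \<open>z\<close>.\<close>

lemma is_L2_iff_nn:
  "is_L2 M f \<longleftrightarrow> f \<in> borel_measurable M \<and> (\<integral>\<^sup>+x. ennreal ((cmod (f x))\<^sup>2) \<partial>M) < \<infinity>"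
  unfolding is_L2_def by (auto simp: integrable_iff_bounded)

lemma l2norm_nonneg [simp]: "0 \<le> l2norm M f"
  by (simp add: l2norm_def)

lemma l2norm_power2: "(l2norm M f)\<^sup>2 = (\<integral>x. (cmod (f x))\<^sup>2 \<partial>M)"
  by (simp add: l2norm_def)

lemma nn_integral_l2norm:
  "is_L2 M f \<Longrightarrow> (\<integral>\<^sup>+x. ennreal ((cmod (f x))\<^sup>2) \<partial>M) = ennreal ((l2norm M f)\<^sup>2)"
  unfolding l2norm_power2 is_L2_def by (intro nn_integral_eq_integral) auto

lemma l2norm_le_nnI:
  assumes "is_L2 M f" "(\<integral>\<^sup>+x. ennreal ((cmod (f x))\<^sup>2) \<partial>M) \<le> ennreal (c\<^sup>2)" "0 \<le> c"
  shows "l2norm M f \<le> c"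
  using assms by (simp add: nn_integral_l2norm abs_le_square_iff[symmetric])

lemma is_L2_dominated:
  assumes "is_L2 M g" "f \<in> borel_measurable M" "AE x in M. cmod (f x) \<le> cmod (g x)"
  shows "is_L2 M f"
  unfolding is_L2_def
proof
  show "integrable M (\<lambda>x. (cmod (f x))\<^sup>2)"
    by (rule Bochner_Integration.integrable_bound[where f="\<lambda>x. (cmod (g x))\<^sup>2"])
      (use assms in \<open>auto simp: is_L2_def power_mono elim!: eventually_mono\<close>)
qed (use assms in auto)

lemma l2norm_mono:
  assumes "is_L2 M g" "f \<in> borel_measurable M" "AE x in M. cmod (f x) \<le> cmod (g x)"
  shows "l2norm M f \<le> l2norm M g"
proof -
  have "is_L2 M f" using assms by (rule is_L2_dominated)
  then show ?thesis
    using assms unfolding l2norm_def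
    by (intro real_sqrt_le_mono integral_mono_AE)
      (auto simp: is_L2_def power_mono elim!: eventually_mono)
qed

lemma l2norm_cong_AE:
  assumes "f \<in> borel_measurable M" "g \<in> borel_measurable M" "AE x in M. f x = g x"
  shows "l2norm M f = l2norm M g"
  unfolding l2norm_def using assms
  by (intro arg_cong[where f=sqrt] integral_cong_AE) (auto elim: eventually_mono)

lemma l2norm_eq_0_iff:
  assumes "is_L2 M f"
  shows "l2norm M f = 0 \<longleftrightarrow> (AE x in M. f x = 0)"
  using assms integral_nonneg_eq_0_iff_AE[of M "\<lambda>x. (cmod (f x))\<^sup>2"]
  unfolding l2norm_def is_L2_def by auto

lemma is_L2_zero [simp]: "is_L2 M (\<lambda>x. 0)" and l2norm_zero [simp]: "l2norm M (\<lambda>x. 0) = 0"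
  by (auto simp: is_L2_def l2norm_def)

lemma is_L2_cmult: "is_L2 M f \<Longrightarrow> is_L2 M (\<lambda>x. c * f x)"
  by (auto simp: is_L2_def norm_mult power_mult_distrib)

lemma l2norm_cmult: "l2norm M (\<lambda>x. c * f x) = cmod c * l2norm M f"
  by (simp add: l2norm_def norm_mult power_mult_distrib real_sqrt_mult)

lemma l2norm_uminus [simp]: "l2norm M (\<lambda>x. - f x) = l2norm M f"
  by (simp add: l2norm_def)

lemma l2norm_minus_commute: "l2norm M (\<lambda>x. f x - g x) = l2norm M (\<lambda>x. g x - f x)"
  by (simp add: l2norm_def norm_minus_commute)

lemma is_L2_cnj: "is_L2 M f \<Longrightarrow> is_L2 M (\<lambda>x. cnj (f x))"
  by (auto simp: is_L2_def intro: borel_measurable_continuous_on continuous_intros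
      intro!: measurable_compose[OF _ borel_measurable_continuous_onI[OF continuous_on_cnj]])

lemma l2norm_cnj [simp]: "l2norm M (\<lambda>x. cnj (f x)) = l2norm M f"
  by (simp add: l2norm_def)

lemma L2_integrable_mult:
  assumes "is_L2 M f" "is_L2 M g"
  shows "integrable M (\<lambda>x. f x * g x)"
proof (rule Bochner_Integration.integrable_bound[where f="\<lambda>x. (cmod (f x))\<^sup>2 + (cmod (g x))\<^sup>2"])
  show "AE x in M. norm (f x * g x) \<le> norm ((cmod (f x))\<^sup>2 + (cmod (g x))\<^sup>2)"
  proof (rule AE_I2)
    fix x
    have "2 * (cmod (f x) * cmod (g x)) \<le> (cmod (f x))\<^sup>2 + (cmod (g x))\<^sup>2"
      using sum_squares_bound[of "cmod (f x)" "cmod (g x)"] by simp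
    moreover have "0 \<le> cmod (f x) * cmod (g x)" by simp
    ultimately have "cmod (f x) * cmod (g x) \<le> (cmod (f x))\<^sup>2 + (cmod (g x))\<^sup>2" by linarith
    then show "norm (f x * g x) \<le> norm ((cmod (f x))\<^sup>2 + (cmod (g x))\<^sup>2)"
      by (simp add: norm_mult)
  qed
qed (use assms in \<open>auto simp: is_L2_def\<close>)

lemma l2norm_Holder:
  assumes f: "is_L2 M f" and g: "is_L2 M g"
  shows "(\<integral>x. cmod (f x * g x) \<partial>M) \<le> l2norm M f * l2norm M g"
proof -
  define a b I where "a = l2norm M f" and "b = l2norm M g"
    and "I = (\<integral>x. cmod (f x * g x) \<partial>M)"
  have int: "integrable M (\<lambda>x. (cmod (f x))\<^sup>2)" "integrable M (\<lambda>x. (cmod (g x))\<^sup>2)"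
    "integrable M (\<lambda>x. cmod (f x) * cmod (g x))"
    using f g L2_integrable_mult[OF f g, THEN integrable_norm]
    by (auto simp: is_L2_def norm_mult)
  have I0: "0 \<le> I" by (simp add: I_def)
  \<comment> \<open>The square of \<open>t * cmod (f x) - cmod (g x)\<close> integrates to a
    nonnegative quadratic polynomial in \<open>t\<close>.\<close>
  have *: "0 \<le> t\<^sup>2 * a\<^sup>2 - 2 * t * I + b\<^sup>2" for t
  proof -
    have "0 \<le> (\<integral>x. (t * cmod (f x) - cmod (g x))\<^sup>2 \<partial>M)" by simp
    also have "\<dots> = (\<integral>x. t\<^sup>2 * (cmod (f x))\<^sup>2 - 2 * t * (cmod (f x) * cmod (g x)) + (cmod (g x))\<^sup>2 \<partial>M)"
      by (intro Bochner_Integration.integral_cong) (auto simp: power2_eq_square algebra_simps)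
    also have "\<dots> = t\<^sup>2 * a\<^sup>2 - 2 * t * I + b\<^sup>2"
      using int by (simp add: a_def b_def I_def l2norm_power2 norm_mult)
    finally show ?thesis .
  qed
  have "I \<le> a * b"
  proof (cases "a = 0")
    case True
    have "I = 0"
    proof (rule ccontr)
      assume "I \<noteq> 0"
      \<comment> \<open>For \<open>a = 0\<close> the quadratic is linear, and this \<open>t\<close>
        gives it the value \<open>-1\<close>.\<close>
      with *[of "(b\<^sup>2 + 1) / (2 * I)"] True show False by (simp add: field_simps)
    qed
    with True show ?thesis by simp
  next
    case False
    then have a: "a > 0" by (simp add: a_def less_le)
    \<comment> \<open>\<open>I / a\<^sup>2\<close> is the minimiser of the quadratic.\<close>
    have "0 \<le> (I / a\<^sup>2)\<^sup>2 * a\<^sup>2 - 2 * (I / a\<^sup>2) * I + b\<^sup>2" by (rule *)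
    also have "\<dots> = b\<^sup>2 - I\<^sup>2 / a\<^sup>2" using a by (simp add: field_simps power2_eq_square)
    finally have "I\<^sup>2 \<le> (a * b)\<^sup>2" using a by (simp add: field_simps power_mult_distrib)
    then show ?thesis by (rule power2_le_imp_le) (simp add: a_def b_def)
  qed
  then show ?thesis by (simp add: a_def b_def I_def)
qed

lemma is_L2_add:
  assumes "is_L2 M f" "is_L2 M g"
  shows "is_L2 M (\<lambda>x. f x + g x)"
proof -
  have "integrable M (\<lambda>x. (cmod (f x))\<^sup>2 + (cmod (g x))\<^sup>2 + 2 * cmod (f x * g x))"
    using assms L2_integrable_mult[OF assms, THEN integrable_norm] by (auto simp: is_L2_def)
  then have "integrable M (\<lambda>x. (cmod (f x + g x))\<^sup>2)"
  proof (rule Bochner_Integration.integrable_bound)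
    show "AE x in M. norm ((cmod (f x + g x))\<^sup>2) \<le> norm ((cmod (f x))\<^sup>2 + (cmod (g x))\<^sup>2 + 2 * cmod (f x * g x))"
    proof (rule AE_I2)
      fix x
      have "(cmod (f x + g x))\<^sup>2 \<le> (cmod (f x) + cmod (g x))\<^sup>2"
        by (intro power_mono norm_triangle_ineq) auto
      then show "norm ((cmod (f x + g x))\<^sup>2) \<le> norm ((cmod (f x))\<^sup>2 + (cmod (g x))\<^sup>2 + 2 * cmod (f x * g x))"
        by (simp add: power2_sum norm_mult)
    qed
  qed (use assms in \<open>auto simp: is_L2_def\<close>)
  with assms show ?thesis by (auto simp: is_L2_def)
qed

lemma l2norm_triangle:
  assumes "is_L2 M f" "is_L2 M g"
  shows "l2norm M (\<lambda>x. f x + g x) \<le> l2norm M f + l2norm M g"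
proof (rule power2_le_imp_le)
  have "(l2norm M (\<lambda>x. f x + g x))\<^sup>2 \<le> (\<integral>x. (cmod (f x))\<^sup>2 + (cmod (g x))\<^sup>2 + 2 * cmod (f x * g x) \<partial>M)"
    unfolding l2norm_power2
  proof (rule integral_mono)
    fix x
    have "(cmod (f x + g x))\<^sup>2 \<le> (cmod (f x) + cmod (g x))\<^sup>2"
      by (intro power_mono norm_triangle_ineq) auto
    then show "(cmod (f x + g x))\<^sup>2 \<le> (cmod (f x))\<^sup>2 + (cmod (g x))\<^sup>2 + 2 * cmod (f x * g x)"
      by (simp add: power2_sum norm_mult)
  qed (use assms L2_integrable_mult[OF assms, THEN integrable_norm] is_L2_add[OF assms]
      in \<open>auto simp: is_L2_def\<close>)
  also have "\<dots> = (l2norm M f)\<^sup>2 + (l2norm M g)\<^sup>2 + 2 * (\<integral>x. cmod (f x * g x) \<partial>M)"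
    using assms L2_integrable_mult[OF assms, THEN integrable_norm]
    by (simp add: l2norm_power2 is_L2_def)
  also have "\<dots> \<le> (l2norm M f + l2norm M g)\<^sup>2"
    using l2norm_Holder[OF assms] by (simp add: power2_sum)
  finally show "(l2norm M (\<lambda>x. f x + g x))\<^sup>2 \<le> (l2norm M f + l2norm M g)\<^sup>2" .
qed simp

lemma is_L2_diff: "is_L2 M f \<Longrightarrow> is_L2 M g \<Longrightarrow> is_L2 M (\<lambda>x. f x - g x)"
  using is_L2_add[OF _ is_L2_cmult[of M g "-1"], of f] by simp

lemma l2norm_triangle_sub:
  assumes "is_L2 M f" "is_L2 M g"
  shows "l2norm M f \<le> l2norm M g + l2norm M (\<lambda>x. f x - g x)"
  using l2norm_triangle[OF assms(2) is_L2_diff[OF assms]] by simp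

lemma l2norm_diff_triangle:
  assumes "is_L2 M f" "is_L2 M g" "is_L2 M h"
  shows "l2norm M (\<lambda>x. f x - h x) \<le> l2norm M (\<lambda>x. f x - g x) + l2norm M (\<lambda>x. g x - h x)"
  using l2norm_triangle[OF is_L2_diff[OF assms(1,2)] is_L2_diff[OF assms(2,3)]] by simp

lemma is_L2_sum: "(\<And>i. i \<in> I \<Longrightarrow> is_L2 M (f i)) \<Longrightarrow> is_L2 M (\<lambda>x. \<Sum>i\<in>I. f i x)"
  by (induction I rule: infinite_finite_induct) (auto intro: is_L2_add)

lemma l2norm_sum_le:
  "(\<And>i. i \<in> I \<Longrightarrow> is_L2 M (f i)) \<Longrightarrow> l2norm M (\<lambda>x. \<Sum>i\<in>I. f i x) \<le> (\<Sum>i\<in>I. l2norm M (f i))"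
proof (induction I rule: infinite_finite_induct)
  case (insert i I)
  have "l2norm M (\<lambda>x. f i x + (\<Sum>j\<in>I. f j x)) \<le> l2norm M (f i) + l2norm M (\<lambda>x. \<Sum>j\<in>I. f j x)"
    using insert.prems by (intro l2norm_triangle is_L2_sum) auto
  with insert show ?case by simp
qed auto

lemma cmod_indicator_le_1: "cmod (indicator A x) \<le> 1"
  by (simp add: indicator_def)

lemma is_L2_mult_le1:
  assumes "is_L2 M f" "h \<in> borel_measurable M" "\<And>x. cmod (h x) \<le> 1"
  shows "is_L2 M (\<lambda>x. h x * f x)" "l2norm M (\<lambda>x. h x * f x) \<le> l2norm M f"
  using assms by (auto intro!: is_L2_dominated[OF assms(1)] l2norm_mono[OF assms(1)]
      simp: norm_mult mult_left_le_one_le)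

subsection \<open>Bounded operators\<close>

lemma bounded_op_L2: "bounded_op M T \<Longrightarrow> is_L2 M f \<Longrightarrow> is_L2 M (T f)"
  by (simp add: bounded_op_def)

lemma bounded_op_bound:
  assumes "bounded_op M T"
  obtains C where "0 \<le> C" "\<And>f. is_L2 M f \<Longrightarrow> l2norm M (T f) \<le> C * l2norm M f"
proof -
  obtain C where C: "\<And>f. is_L2 M f \<Longrightarrow> l2norm M (T f) \<le> C * l2norm M f"
    using assms by (auto simp: bounded_op_def)
  have "l2norm M (T f) \<le> max 0 C * l2norm M f" if "is_L2 M f" for f
    using C[OF that] by (meson max.cobounded2 mult_right_mono l2norm_nonneg order_trans)
  then show ?thesis by (intro that[of "max 0 C"]) auto
qed

text \<open>\<open>bounded_op\<close> expresses linearity by a vanishing seminorm, since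
  \<open>T\<close> may change values on null sets; all later algebra with operators therefore runs
  almost everywhere.\<close>

lemma bounded_op_linear_AE:
  assumes "bounded_op M T" "is_L2 M f" "is_L2 M g"
  shows "AE x in M. T (\<lambda>y. f y + c * g y) x = T f x + c * T g x"
proof -
  let ?d = "\<lambda>x. T (\<lambda>y. f y + c * g y) x - T f x - c * T g x"
  have "is_L2 M ?d"
    using assms by (intro is_L2_diff is_L2_cmult bounded_op_L2[OF assms(1)] is_L2_add)
  moreover have "l2norm M ?d = 0" using assms by (auto simp: bounded_op_def)
  ultimately have "AE x in M. ?d x = 0" by (simp add: l2norm_eq_0_iff)
  then show ?thesis by eventually_elim (simp add: algebra_simps)
qed

lemma bounded_opI:
  assumes L2: "\<And>f. is_L2 M f \<Longrightarrow> is_L2 M (T f)"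
    and lin: "\<And>f g c. is_L2 M f \<Longrightarrow> is_L2 M g \<Longrightarrow>
      AE x in M. T (\<lambda>y. f y + c * g y) x = T f x + c * T g x"
    and bd: "\<And>f. is_L2 M f \<Longrightarrow> l2norm M (T f) \<le> C * l2norm M f"
  shows "bounded_op M T"
  unfolding bounded_op_def
proof (intro conjI allI impI)
  fix f g :: "'a \<Rightarrow> complex" and c assume *: "is_L2 M f" "is_L2 M g"
  let ?d = "\<lambda>x. T (\<lambda>y. f y + c * g y) x - T f x - c * T g x"
  have "is_L2 M ?d" using * by (intro is_L2_diff is_L2_cmult L2 is_L2_add)
  moreover have "AE x in M. ?d x = 0" using lin[OF *, of c] by eventually_elim simp
  ultimately show "l2norm M ?d = 0" by (simp add: l2norm_eq_0_iff)
qed (use L2 bd in auto)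

lemma bounded_op_zero_AE:
  assumes "bounded_op M T" shows "AE x in M. T (\<lambda>y. 0) x = 0"
  using bounded_op_linear_AE[OF assms is_L2_zero is_L2_zero, of 1] by simp

lemma bounded_op_cmult_AE:
  assumes "bounded_op M T" "is_L2 M f"
  shows "AE x in M. T (\<lambda>y. c * f y) x = c * T f x"
  using bounded_op_linear_AE[OF assms(1) is_L2_zero assms(2), of c] bounded_op_zero_AE[OF assms(1)]
  by eventually_elim simp

lemma bounded_op_sum_AE:
  assumes T: "bounded_op M T" and f: "\<And>i. i \<in> I \<Longrightarrow> is_L2 M (f i)"
  shows "AE x in M. T (\<lambda>y. \<Sum>i\<in>I. c i * f i y) x = (\<Sum>i\<in>I. c i * T (f i) x)"
  using f
proof (induction I rule: infinite_finite_induct)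
  case (insert i I)
  have "AE x in M. T (\<lambda>y. (\<Sum>j\<in>I. c j * f j y) + c i * f i y) x
      = T (\<lambda>y. \<Sum>j\<in>I. c j * f j y) x + c i * T (f i) x"
    using insert.prems by (intro bounded_op_linear_AE[OF T] is_L2_sum is_L2_cmult) auto
  moreover have "AE x in M. T (\<lambda>y. \<Sum>j\<in>I. c j * f j y) x = (\<Sum>j\<in>I. c j * T (f j) x)"
    using insert by auto
  ultimately show ?case
    by eventually_elim (use insert in \<open>simp add: add.commute\<close>)
qed (use bounded_op_zero_AE[OF T] in auto)

lemma bounded_op_diff:
  assumes "bounded_op M T" "bounded_op M S"
  shows "bounded_op M (\<lambda>f x. T f x - S f x)"
proof -
  obtain C where C: "\<And>f. is_L2 M f \<Longrightarrow> l2norm M (T f) \<le> C * l2norm M f"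
    using bounded_op_bound[OF assms(1)] by metis
  obtain D where D: "\<And>f. is_L2 M f \<Longrightarrow> l2norm M (S f) \<le> D * l2norm M f"
    using bounded_op_bound[OF assms(2)] by metis
  show ?thesis
  proof (rule bounded_opI)
    fix f g c assume *: "is_L2 M f" "is_L2 M g"
    show "AE x in M. T (\<lambda>y. f y + c * g y) x - S (\<lambda>y. f y + c * g y) x
        = T f x - S f x + c * (T g x - S g x)"
      using bounded_op_linear_AE[OF assms(1) *, of c] bounded_op_linear_AE[OF assms(2) *, of c]
      by eventually_elim (simp add: algebra_simps)
  next
    fix f assume f: "is_L2 M f"
    note L2 = bounded_op_L2[OF assms(1) f] bounded_op_L2[OF assms(2) f]
    show "is_L2 M (\<lambda>x. T f x - S f x)" using L2 by (rule is_L2_diff)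
    have "l2norm M (\<lambda>x. T f x + - S f x) \<le> l2norm M (T f) + l2norm M (\<lambda>x. - S f x)"
      using L2 is_L2_cmult[OF L2(2), of "-1"] by (intro l2norm_triangle) auto
    also have "\<dots> \<le> (C + D) * l2norm M f" using C[OF f] D[OF f] by (simp add: algebra_simps)
    finally show "l2norm M (\<lambda>x. T f x - S f x) \<le> (C + D) * l2norm M f" by simp
  qed
qed

lemma bounded_op_mult:
  assumes T: "bounded_op M T" and h: "h \<in> borel_measurable M" "\<And>x. cmod (h x) \<le> 1"
  shows "bounded_op M (\<lambda>f x. h x * T f x)"
proof -
  obtain C where C: "\<And>f. is_L2 M f \<Longrightarrow> l2norm M (T f) \<le> C * l2norm M f"
    using bounded_op_bound[OF T] by metis
  show ?thesis
  proof (rule bounded_opI)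
    fix f g c assume *: "is_L2 M f" "is_L2 M g"
    show "AE x in M. h x * T (\<lambda>y. f y + c * g y) x = h x * T f x + c * (h x * T g x)"
      using bounded_op_linear_AE[OF T *, of c] by eventually_elim (simp add: algebra_simps)
  next
    fix f assume f: "is_L2 M f"
    note m = is_L2_mult_le1[OF bounded_op_L2[OF T f] h]
    from m show "is_L2 M (\<lambda>x. h x * T f x)" by simp
    from m C[OF f] show "l2norm M (\<lambda>x. h x * T f x) \<le> C * l2norm M f" by simp
  qed
qed

lemma l2norm_le_opnorm:
  assumes T: "bounded_op M T" and f: "is_L2 M f"
  shows "l2norm M (T f) \<le> opnorm M T * l2norm M f"
proof -
  obtain C where C: "0 \<le> C" "\<And>f. is_L2 M f \<Longrightarrow> l2norm M (T f) \<le> C * l2norm M f"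
    using bounded_op_bound[OF T] by metis
  \<comment> \<open>\<open>opnorm\<close> is a raw supremum of reals, which bounds the members of
    the set only if the set is bounded above.\<close>
  have bdd: "bdd_above {l2norm M (T f) | f. is_L2 M f \<and> l2norm M f \<le> 1}"
  proof (rule bdd_aboveI[of _ C], safe)
    fix f assume "is_L2 M f" "l2norm M f \<le> 1"
    then show "l2norm M (T f) \<le> C" using C mult_left_le by (meson order_trans)
  qed
  show ?thesis
  proof (cases "l2norm M f = 0")
    \<comment> \<open>Rescaling to norm one is impossible here, but boundedness already gives
      \<open>T f\<close> norm zero.\<close>
    case True then show ?thesis using C(2)[OF f] by simp
  next
    case False
    then have n: "l2norm M f > 0" by (simp add: less_le)
    define c where "c = complex_of_real (1 / l2norm M f)"
    have cn: "cmod c = 1 / l2norm M f" using n by (simp add: c_def norm_divide)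
    have "l2norm M (T (\<lambda>y. c * f y)) \<le> opnorm M T"
      unfolding opnorm_def using n f bdd
      by (intro cSup_upper) (auto simp: l2norm_cmult cn intro!: is_L2_cmult exI[of _ "\<lambda>y. c * f y"])
    moreover have "l2norm M (T (\<lambda>y. c * f y)) = l2norm M (\<lambda>x. c * T f x)"
      using bounded_op_cmult_AE[OF T f, of c] bounded_op_L2[OF T] f is_L2_cmult
      by (intro l2norm_cong_AE) (auto simp: is_L2_def)
    ultimately show ?thesis using n by (simp add: l2norm_cmult cn field_simps)
  qed
qed

text \<open>The zero function keeps the set of norms nonempty, so its supremum lies below every
  upper bound.\<close>

lemma opnorm_le:
  assumes "\<And>f. is_L2 M f \<Longrightarrow> l2norm M f \<le> 1 \<Longrightarrow> l2norm M (T f) \<le> c"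
  shows "opnorm M T \<le> c"
  unfolding opnorm_def by (rule cSup_least) (use assms is_L2_zero in \<open>auto intro!: exI[of _ "\<lambda>x. 0"]\<close>)

subsection \<open>Orthogonality and compact operators\<close>

text \<open>Antilinear in the first argument, so that \<open>cip M (v i) f\<close> is the
  coefficient of \<open>f\<close> along \<open>v i\<close>.\<close>

definition cip :: "'a measure \<Rightarrow> ('a \<Rightarrow> complex) \<Rightarrow> ('a \<Rightarrow> complex) \<Rightarrow> complex" where
  "cip M f g = (\<integral>x. cnj (f x) * g x \<partial>M)"

lemma cip_integrable: "is_L2 M f \<Longrightarrow> is_L2 M g \<Longrightarrow> integrable M (\<lambda>x. cnj (f x) * g x)"
  by (intro L2_integrable_mult is_L2_cnj)

lemma cip_add_right:
  "is_L2 M f \<Longrightarrow> is_L2 M g \<Longrightarrow> is_L2 M h \<Longrightarrow> cip M f (\<lambda>x. g x + h x) = cip M f g + cip M f h"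
  by (simp add: cip_def distrib_left cip_integrable)

lemma cip_cmult_right: "cip M f (\<lambda>x. c * g x) = c * cip M f g"
  by (simp add: cip_def mult.left_commute)

lemma cip_diff_right:
  "is_L2 M f \<Longrightarrow> is_L2 M g \<Longrightarrow> is_L2 M h \<Longrightarrow> cip M f (\<lambda>x. g x - h x) = cip M f g - cip M f h"
  by (simp add: cip_def right_diff_distrib cip_integrable)

lemma cip_sum_right:
  assumes "is_L2 M f" "\<And>i. i \<in> I \<Longrightarrow> is_L2 M (g i)"
  shows "cip M f (\<lambda>x. \<Sum>i\<in>I. g i x) = (\<Sum>i\<in>I. cip M f (g i))"
  using assms unfolding cip_def sum_distrib_left
  by (intro Bochner_Integration.integral_sum cip_integrable) auto

lemma cip_commute: "cip M g f = cnj (cip M f g)"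
  unfolding cip_def by (subst Bochner_Integration.integral_cnj[symmetric]) (simp add: mult.commute)

lemma cip_self: "cip M f f = of_real ((l2norm M f)\<^sup>2)"
  unfolding cip_def l2norm_power2
  by (simp flip: integral_complex_of_real complex_norm_square add: mult.commute)

lemma cip_norm_le:
  assumes "is_L2 M f" "is_L2 M g"
  shows "cmod (cip M f g) \<le> l2norm M f * l2norm M g"
proof -
  have "cmod (cip M f g) \<le> (\<integral>x. cmod (cnj (f x) * g x) \<partial>M)"
    unfolding cip_def by (rule integral_norm_bound)
  also have "\<dots> \<le> l2norm M f * l2norm M g"
    using l2norm_Holder[OF is_L2_cnj[OF assms(1)] assms(2)] by simp
  finally show ?thesis .
qed

lemma l2norm_Pythagoras:
  assumes f: "is_L2 M f" and g: "is_L2 M g" and "cip M f g = 0"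
  shows "(l2norm M (\<lambda>x. f x + g x))\<^sup>2 = (l2norm M f)\<^sup>2 + (l2norm M g)\<^sup>2"
proof -
  note fg = is_L2_add[OF f g]
  have gf: "cip M g f = 0" using cip_commute[of M g f] assms by simp
  \<comment> \<open>Additivity is at hand in the second argument only; conjugation carries it over
    to the first.\<close>
  have "cip M (\<lambda>x. f x + g x) (\<lambda>x. f x + g x) = cnj (cip M f (\<lambda>x. f x + g x)) + cnj (cip M g (\<lambda>x. f x + g x))"
    unfolding cip_add_right[OF fg f g] by (simp only: cip_commute[of M "\<lambda>x. f x + g x"])
  also have "\<dots> = cip M f f + cip M g g"
    using assms gf by (simp add: cip_add_right cip_self)
  finally show ?thesis
    unfolding cip_self by (simp flip: of_real_add del: of_real_power)
qed

definition orthonormal_on :: "'a measure \<Rightarrow> 'i set \<Rightarrow> ('i \<Rightarrow> 'a \<Rightarrow> complex) \<Rightarrow> bool" where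
  "orthonormal_on M I v \<longleftrightarrow> (\<forall>i\<in>I. is_L2 M (v i)) \<and>
     (\<forall>i\<in>I. \<forall>j\<in>I. cip M (v i) (v j) = (if i = j then 1 else 0))"

lemma orthonormal_onD:
  assumes "orthonormal_on M I v" "i \<in> I"
  shows "is_L2 M (v i)" "l2norm M (v i) = 1" "j \<in> I \<Longrightarrow> cip M (v i) (v j) = (if i = j then 1 else 0)"
proof -
  have "of_real ((l2norm M (v i))\<^sup>2) = (of_real 1 :: complex)"
    using assms cip_self[of M "v i"] by (auto simp: orthonormal_on_def)
  then have "(l2norm M (v i))\<^sup>2 = 1" by (simp only: of_real_eq_iff)
  then show "l2norm M (v i) = 1" using l2norm_nonneg[of M "v i"] by (simp add: power2_eq_1_iff)
qed (use assms in \<open>auto simp: orthonormal_on_def\<close>)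

lemma orthonormal_on_subset: "orthonormal_on M I v \<Longrightarrow> J \<subseteq> I \<Longrightarrow> orthonormal_on M J v"
  unfolding orthonormal_on_def by (simp add: subset_iff)

lemma l2norm_orthonormal_sum:
  assumes "finite I" "orthonormal_on M I v"
  shows "(l2norm M (\<lambda>x. \<Sum>i\<in>I. v i x))\<^sup>2 = card I"
  using assms
proof (induction I rule: finite_induct)
  case (insert i I)
  then have v: "orthonormal_on M I v" by (auto intro: orthonormal_on_subset)
  have L2: "is_L2 M (v j)" if "j \<in> insert i I" for j
    using insert.prems that by (rule orthonormal_onD)
  have "cip M (v i) (\<lambda>x. \<Sum>j\<in>I. v j x) = (\<Sum>j\<in>I. cip M (v i) (v j))"
    using L2 by (intro cip_sum_right) auto
  also have "\<dots> = 0"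
    using insert.prems insert.hyps by (intro sum.neutral) (auto simp: orthonormal_on_def)
  finally have "(l2norm M (\<lambda>x. v i x + (\<Sum>j\<in>I. v j x)))\<^sup>2
      = (l2norm M (v i))\<^sup>2 + (l2norm M (\<lambda>x. \<Sum>j\<in>I. v j x))\<^sup>2"
    using L2 by (intro l2norm_Pythagoras is_L2_sum) auto
  then show ?case
    using insert v orthonormal_onD(2)[OF insert.prems] by simp
qed simp

text \<open>The residual \<open>g\<close> is orthogonal to the projection of \<open>f\<close>, so
  Pythagoras applied to their sum \<open>f\<close> bounds its norm.\<close>

lemma orthonormal_residual:
  assumes I: "finite I" and v: "orthonormal_on M I v" and f: "is_L2 M f"
  defines "g \<equiv> \<lambda>x. f x - (\<Sum>i\<in>I. cip M (v i) f * v i x)"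
  shows "is_L2 M g" "\<And>i. i \<in> I \<Longrightarrow> cip M (v i) g = 0" "l2norm M g \<le> l2norm M f"
proof -
  let ?p = "\<lambda>x. \<Sum>i\<in>I. cip M (v i) f * v i x"
  have L2: "is_L2 M (v i)" if "i \<in> I" for i using v that by (rule orthonormal_onD)
  have p: "is_L2 M ?p" by (intro is_L2_sum is_L2_cmult L2)
  show g: "is_L2 M g" unfolding g_def by (intro is_L2_diff f p)
  show orth: "cip M (v i) g = 0" if i: "i \<in> I" for i
  proof -
    have "cip M (v i) g = cip M (v i) f - (\<Sum>j\<in>I. cip M (v i) (\<lambda>x. cip M (v j) f * v j x))"
      unfolding g_def cip_diff_right[OF L2[OF i] f p]
      by (subst cip_sum_right) (auto intro: is_L2_cmult L2 i)
    also have "(\<Sum>j\<in>I. cip M (v i) (\<lambda>x. cip M (v j) f * v j x)) = (\<Sum>j\<in>I. if i = j then cip M (v j) f else 0)"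
      using v i by (intro sum.cong) (auto simp: cip_cmult_right orthonormal_on_def)
    finally show ?thesis using I i by simp
  qed
  have "cip M g ?p = (\<Sum>i\<in>I. cip M g (\<lambda>x. cip M (v i) f * v i x))"
    by (intro cip_sum_right g is_L2_cmult L2)
  also have "\<dots> = 0"
    using orth by (intro sum.neutral) (simp add: cip_cmult_right cip_commute[of M g])
  finally have "(l2norm M (\<lambda>x. g x + ?p x))\<^sup>2 = (l2norm M g)\<^sup>2 + (l2norm M ?p)\<^sup>2"
    by (intro l2norm_Pythagoras g p)
  then have "(l2norm M g)\<^sup>2 \<le> (l2norm M f)\<^sup>2" by (simp add: g_def)
  then show "l2norm M g \<le> l2norm M f" by (rule power2_le_imp_le) simp
qed

text \<open>Fibres of size at most \<open>m\<close> hold at most \<open>card F * m\<close> indices;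
  the \<open>+ 1\<close> forces a larger one. It will sort orthonormal vectors by the net point near
  their images.\<close>

lemma pigeonhole_large_fibre:
  assumes "finite F" "f ` {..<card F * m + 1} \<subseteq> F"
  obtains w where "w \<in> F" "m < card {i \<in> {..<card F * m + 1}. f i = w}"
proof -
  have "\<exists>w\<in>F. m < card {i \<in> {..<card F * m + 1}. f i = w}"
  proof (rule ccontr)
    assume "\<not> ?thesis"
    then have le: "card {i \<in> {..<card F * m + 1}. f i = w} \<le> m" if "w \<in> F" for w
      using that by auto
    have "{..<card F * m + 1} = (\<Union>w\<in>F. {i \<in> {..<card F * m + 1}. f i = w})"
      using assms by auto
    then have "card {..<card F * m + 1} \<le> (\<Sum>w\<in>F. card {i \<in> {..<card F * m + 1}. f i = w})"
      using card_UN_le[OF assms(1)] by metis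
    also have "\<dots> \<le> card F * m" using sum_bounded_above[of F, OF le] by simp
    finally show False by simp
  qed
  then show ?thesis using that by blast
qed

text \<open>If the claim failed, there would be arbitrarily many orthonormal vectors whose images
  have norm \<open>> e\<close>; by total boundedness, \<open>m\<close> of these images lie close to a common vector, so
  the image of their sum has norm of order \<open>m\<close>, whereas the sum itself has norm \<open>sqrt m\<close>.\<close>

lemma compact_op_small_on_complement:
  assumes T: "compact_op M T" and e: "0 < e"
  shows "\<exists>n (v :: nat \<Rightarrow> 'a \<Rightarrow> complex). orthonormal_on M {..<n} v \<and>
    (\<forall>g. is_L2 M g \<longrightarrow> (\<forall>i<n. cip M (v i) g = 0) \<longrightarrow> l2norm M (T g) \<le> e * l2norm M g)"
proof (rule ccontr)
  assume "\<not> ?thesis"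
  then have ex: "\<exists>g. is_L2 M g \<and> (\<forall>i<n. cip M (v i) g = 0) \<and> e * l2norm M g < l2norm M (T g)"
    if "orthonormal_on M {..<n} v" for n and v :: "nat \<Rightarrow> 'a \<Rightarrow> complex"
    using that not_le by metis
  have bT: "bounded_op M T" using T by (simp add: compact_op_def)
  obtain C where C: "0 \<le> C" "\<And>f. is_L2 M f \<Longrightarrow> l2norm M (T f) \<le> C * l2norm M f"
    using bounded_op_bound[OF bT] by metis
  \<comment> \<open>The negated claim, applied to the vectors found so far, supplies a further
    vector orthogonal to them; normalised, it extends the system.\<close>
  have big: "\<exists>v :: nat \<Rightarrow> 'a \<Rightarrow> complex. orthonormal_on M {..<n} v \<and> (\<forall>i<n. e < l2norm M (T (v i)))" for n
  proof (induction n)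
    case 0 show ?case by (auto simp: orthonormal_on_def)
  next
    case (Suc n)
    then obtain v where v: "orthonormal_on M {..<n} v" "\<And>i. i < n \<Longrightarrow> e < l2norm M (T (v i))"
      by auto
    obtain g where g: "is_L2 M g" "\<And>i. i < n \<Longrightarrow> cip M (v i) g = 0" "e * l2norm M g < l2norm M (T g)"
      using ex[OF v(1)] by auto
    have "l2norm M g \<noteq> 0" using g(3) C(2)[OF g(1)] by auto
    then have pos: "0 < l2norm M g" by (simp add: less_le)
    define c where "c = complex_of_real (1 / l2norm M g)"
    have cn: "cmod c = 1 / l2norm M g" using pos by (simp add: c_def norm_divide)
    define h where "h = (\<lambda>x. c * g x)"
    have h: "is_L2 M h" using g(1) by (simp add: h_def is_L2_cmult)
    have "l2norm M h = 1" using pos by (simp add: h_def l2norm_cmult cn)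
    then have hh: "cip M h h = 1" by (simp add: cip_self)
    have vh: "cip M (v i) h = 0" if "i < n" for i using g(2)[OF that] by (simp add: h_def cip_cmult_right)
    have hv: "cip M h (v i) = 0" if "i < n" for i using vh[OF that] by (simp add: cip_commute[of M h])
    have "l2norm M (T h) = l2norm M (\<lambda>x. c * T g x)"
      using bounded_op_cmult_AE[OF bT g(1), of c] bounded_op_L2[OF bT g(1)] bounded_op_L2[OF bT h]
      by (intro l2norm_cong_AE) (auto simp: is_L2_def h_def)
    then have "e < l2norm M (T h)"
      using g(3) pos by (simp add: l2norm_cmult cn pos_less_divide_eq)
    moreover have "orthonormal_on M {..<Suc n} (v(n := h))"
      unfolding orthonormal_on_def
    proof (intro conjI ballI)
      fix i j assume ij: "i \<in> {..<Suc n}" "j \<in> {..<Suc n}"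
      show "cip M ((v(n := h)) i) ((v(n := h)) j) = (if i = j then 1 else 0)"
        using ij hh hv[of j] vh[of i] orthonormal_onD(3)[OF v(1), of i j]
        by (cases "i = n"; cases "j = n") auto
    qed (use h orthonormal_onD(1)[OF v(1)] in auto)
    moreover have "\<forall>i<Suc n. e < l2norm M (T ((v(n := h)) i))"
      using v(2) \<open>e < l2norm M (T h)\<close> by (simp add: less_Suc_eq)
    ultimately show ?case by blast
  qed
  have "e / 4 > 0" using e by simp
  then have "\<exists>F. finite F \<and> (\<forall>g\<in>F. is_L2 M g) \<and>
      (\<forall>f. is_L2 M f \<and> l2norm M f \<le> 1 \<longrightarrow> (\<exists>g\<in>F. l2norm M (\<lambda>x. T f x - g x) < e / 4))"
    using T unfolding compact_op_def by blast
  then obtain F where F: "finite F" "\<And>g. g \<in> F \<Longrightarrow> is_L2 M g"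
    "\<And>f. is_L2 M f \<Longrightarrow> l2norm M f \<le> 1 \<Longrightarrow> \<exists>g\<in>F. l2norm M (\<lambda>x. T f x - g x) < e / 4"
    by blast
  \<comment> \<open>Beyond this threshold \<open>n * (e / 2) \<le> C * sqrt n\<close> is
    impossible.\<close>
  obtain m :: nat where m: "(2 * C / e)\<^sup>2 < m" using reals_Archimedean2 by blast
  define N where "N = card F * m + 1"
  obtain v where v: "orthonormal_on M {..<N} v" "\<And>i. i < N \<Longrightarrow> e < l2norm M (T (v i))"
    using big by blast
  have "\<exists>g\<in>F. l2norm M (\<lambda>x. T (v i) x - g x) < e / 4" if "i < N" for i
    using orthonormal_onD[OF v(1), of i] that by (intro F(3)) auto
  then obtain u where u: "\<And>i. i < N \<Longrightarrow> u i \<in> F" "\<And>i. i < N \<Longrightarrow> l2norm M (\<lambda>x. T (v i) x - u i x) < e / 4"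
    by metis
  obtain w where w: "w \<in> F" "m < card {i \<in> {..<N}. u i = w}"
    using pigeonhole_large_fibre[of F u m] F(1) u(1) unfolding N_def by blast
  define J where "J = {i \<in> {..<N}. u i = w}"
  have J: "finite J" "m < card J" "J \<subseteq> {..<N}" using w by (auto simp: J_def)
  have vL: "is_L2 M (v j)" if "j \<in> J" for j
    using orthonormal_onD(1)[OF v(1)] that J by blast
  have TL: "is_L2 M (T (v j))" if "j \<in> J" for j using bounded_op_L2[OF bT vL[OF that]] .
  have wL: "is_L2 M w" using F w by auto
  have close: "l2norm M (\<lambda>x. T (v j) x - w x) < e / 4" if "j \<in> J" for j
    using u that by (auto simp: J_def)
  define n where "n = real (card J)"
  have n0: "n > 0" using J by (simp add: n_def)
  then obtain j where j: "j \<in> J" by (auto simp: n_def card_gt_0_iff)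
  have wbig: "3 * e / 4 < l2norm M w"
    using l2norm_triangle_sub[OF TL[OF j] wL] close[OF j] v(2)[of j] j J by auto
  let ?s = "\<lambda>x. \<Sum>j\<in>J. T (v j) x" and ?d = "\<lambda>x. \<Sum>j\<in>J. T (v j) x - w x"
  have sL: "is_L2 M ?s" by (intro is_L2_sum TL)
  have "l2norm M ?d \<le> (\<Sum>j\<in>J. l2norm M (\<lambda>x. T (v j) x - w x))"
    by (intro l2norm_sum_le is_L2_diff TL wL)
  also have "\<dots> \<le> n * (e / 4)"
    using sum_bounded_above[of J "\<lambda>j. l2norm M (\<lambda>x. T (v j) x - w x)" "e / 4"] close
    by (simp add: n_def less_imp_le)
  finally have d: "l2norm M ?d \<le> n * (e / 4)" .
  \<comment> \<open>All summands lie near the same \<open>w\<close> and cannot cancel: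
    \<open>n * w\<close> has norm above \<open>n * (3 * e / 4)\<close> and is within
    \<open>n * (e / 4)\<close> of the sum, which leaves \<open>n * (e / 2)\<close>.\<close>
  have "n * l2norm M w = l2norm M (\<lambda>x. of_real n * w x)" using n0 by (simp add: l2norm_cmult)
  also have "\<dots> \<le> l2norm M ?s + l2norm M (\<lambda>x. of_real n * w x - ?s x)"
    by (intro l2norm_triangle_sub is_L2_cmult wL sL)
  also have "l2norm M (\<lambda>x. of_real n * w x - ?s x) = l2norm M ?d"
    by (subst l2norm_minus_commute) (simp add: sum_subtractf n_def)
  finally have "n * l2norm M w \<le> l2norm M ?s + n * (e / 4)" using d by simp
  moreover have "n * (3 * e / 4) < n * l2norm M w" using wbig n0 by (intro mult_strict_left_mono) auto
  ultimately have s_big: "n * (e / 2) \<le> l2norm M ?s" by (simp add: field_simps)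
  have vsL: "is_L2 M (\<lambda>x. \<Sum>j\<in>J. v j x)" by (intro is_L2_sum vL)
  have "AE x in M. T (\<lambda>y. \<Sum>j\<in>J. v j y) x = ?s x"
    using bounded_op_sum_AE[OF bT, of J v "\<lambda>_. 1"] vL by simp
  then have "l2norm M ?s = l2norm M (T (\<lambda>y. \<Sum>j\<in>J. v j y))"
    using sL bounded_op_L2[OF bT vsL] by (intro l2norm_cong_AE) (auto simp: is_L2_def elim: eventually_mono)
  also have "\<dots> \<le> C * l2norm M (\<lambda>y. \<Sum>j\<in>J. v j y)" by (rule C(2)[OF vsL])
  finally have "n * (e / 2) \<le> C * l2norm M (\<lambda>y. \<Sum>j\<in>J. v j y)" using s_big by simp
  then have "(n * (e / 2))\<^sup>2 \<le> (C * l2norm M (\<lambda>y. \<Sum>j\<in>J. v j y))\<^sup>2"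
    using n0 e by (intro power_mono) auto
  also have "\<dots> = C\<^sup>2 * n"
    using l2norm_orthonormal_sum[OF J(1) orthonormal_on_subset[OF v(1) J(3)]]
    by (simp add: power_mult_distrib n_def)
  finally have "n * (e / 2)\<^sup>2 \<le> C\<^sup>2" using n0 by (simp add: power2_eq_square field_simps)
  then have "n \<le> (2 * C / e)\<^sup>2" using e by (simp add: power2_eq_square field_simps)
  then show False using m J(2) by (simp add: n_def)
qed

subsection \<open>Lipschitz functions of bounded support are dense\<close>

lemma l2norm_dominated_convergence:
  assumes w: "is_L2 M w"
    and s: "\<And>n. s n \<in> borel_measurable M"
    and f: "f \<in> borel_measurable M"
    and lim: "\<And>x. x \<in> space M \<Longrightarrow> (\<lambda>n. s n x) \<longlonglongrightarrow> f x"
    and bd: "\<And>n x. x \<in> space M \<Longrightarrow> cmod (s n x) \<le> cmod (w x)"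
  shows "(\<lambda>n. l2norm M (\<lambda>x. s n x - f x)) \<longlonglongrightarrow> 0"
proof -
  \<comment> \<open>The limit obeys the same bound as the sequence, so \<open>2 * cmod (w x)\<close>
    dominates the difference.\<close>
  have bf: "cmod (f x) \<le> cmod (w x)" if "x \<in> space M" for x
    by (rule LIMSEQ_le_const2[OF tendsto_norm[OF lim[OF that]]]) (use bd that in auto)
  have "(\<lambda>n. \<integral>x. (cmod (s n x - f x))\<^sup>2 \<partial>M) \<longlonglongrightarrow> (\<integral>x. 0 \<partial>M)"
  proof (rule integral_dominated_convergence[where w="\<lambda>x. (2 * cmod (w x))\<^sup>2"])
    show "integrable M (\<lambda>x. (2 * cmod (w x))\<^sup>2)"
      using w by (simp add: is_L2_def power_mult_distrib)
    show "AE x in M. (\<lambda>n. (cmod (s n x - f x))\<^sup>2) \<longlonglongrightarrow> 0"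
    proof (rule AE_I2)
      fix x assume "x \<in> space M"
      from lim[OF this] have "(\<lambda>n. s n x - f x) \<longlonglongrightarrow> 0" by (simp add: LIM_zero)
      then show "(\<lambda>n. (cmod (s n x - f x))\<^sup>2) \<longlonglongrightarrow> 0" using tendsto_norm_zero tendsto_power by fastforce
    qed
    show "AE x in M. norm ((cmod (s n x - f x))\<^sup>2) \<le> (2 * cmod (w x))\<^sup>2" for n
    proof (rule AE_I2)
      fix x assume x: "x \<in> space M"
      have "cmod (s n x - f x) \<le> 2 * cmod (w x)"
        using norm_triangle_ineq4[of "s n x" "f x"] bd[OF x, of n] bf[OF x] by simp
      then show "norm ((cmod (s n x - f x))\<^sup>2) \<le> (2 * cmod (w x))\<^sup>2"
        using power_mono[of "cmod (s n x - f x)" "2 * cmod (w x)" 2] by (simp del: power_mult_distrib)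
    qed
  qed (use s f in auto)
  then have "(\<lambda>n. sqrt (\<integral>x. (cmod (s n x - f x))\<^sup>2 \<partial>M)) \<longlonglongrightarrow> sqrt 0"
    by (intro tendsto_real_sqrt) simp
  then show ?thesis by (simp add: l2norm_def)
qed

text \<open>Lipschitz continuity and boundedness make tensor products of such functions uniformly
  continuous, and bounded support makes them controlled. The support clause ranges over every centre
  \<open>p\<close>, so that no base point has to be fixed.\<close>

definition lipschitz_bs :: "('a::metric_space \<Rightarrow> complex) \<Rightarrow> bool" where
  "lipschitz_bs h \<longleftrightarrow> (\<exists>L. \<forall>x y. cmod (h x - h y) \<le> L * dist x y) \<and> (\<exists>B. \<forall>x. cmod (h x) \<le> B) \<and>
     (\<forall>p. \<exists>R. \<forall>x. R < dist p x \<longrightarrow> h x = 0)"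

lemma lipschitz_bs_add:
  assumes "lipschitz_bs f" "lipschitz_bs g"
  shows "lipschitz_bs (\<lambda>x. f x + g x)"
  unfolding lipschitz_bs_def
proof (intro conjI allI)
  obtain L L' where L: "\<And>x y. cmod (f x - f y) \<le> L * dist x y" "\<And>x y. cmod (g x - g y) \<le> L' * dist x y"
    using assms by (auto simp: lipschitz_bs_def)
  show "\<exists>L. \<forall>x y. cmod (f x + g x - (f y + g y)) \<le> L * dist x y"
  proof (intro exI allI)
    fix x y
    show "cmod (f x + g x - (f y + g y)) \<le> (L + L') * dist x y"
      using norm_triangle_ineq[of "f x - f y" "g x - g y"] L[of x y] by (simp add: algebra_simps)
  qed
  obtain B B' where B: "\<And>x. cmod (f x) \<le> B" "\<And>x. cmod (g x) \<le> B'"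
    using assms by (auto simp: lipschitz_bs_def)
  show "\<exists>B. \<forall>x. cmod (f x + g x) \<le> B"
    using norm_triangle_mono[OF B] by blast
  fix p
  obtain R R' where R: "\<forall>x. R < dist p x \<longrightarrow> f x = 0" "\<forall>x. R' < dist p x \<longrightarrow> g x = 0"
    using assms unfolding lipschitz_bs_def by blast
  then show "\<exists>R. \<forall>x. R < dist p x \<longrightarrow> f x + g x = 0"
    by (intro exI[of _ "max R R'"]) simp
qed

lemma lipschitz_bs_cmult:
  assumes "lipschitz_bs f"
  shows "lipschitz_bs (\<lambda>x. c * f x)"
  unfolding lipschitz_bs_def
proof (intro conjI allI)
  obtain L where L: "\<And>x y. cmod (f x - f y) \<le> L * dist x y" using assms by (auto simp: lipschitz_bs_def)
  have "cmod (c * f x - c * f y) \<le> (cmod c * L) * dist x y" for x y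
    using mult_left_mono[OF L[of x y], of "cmod c"] by (simp add: norm_mult flip: right_diff_distrib)
  then show "\<exists>L. \<forall>x y. cmod (c * f x - c * f y) \<le> L * dist x y" by blast
  obtain B where B: "\<And>x. cmod (f x) \<le> B" using assms by (auto simp: lipschitz_bs_def)
  have "cmod (c * f x) \<le> cmod c * B" for x using B by (simp add: norm_mult mult_left_mono)
  then show "\<exists>B. \<forall>x. cmod (c * f x) \<le> B" by blast
  show "\<exists>R. \<forall>x. R < dist p x \<longrightarrow> c * f x = 0" for p using assms by (metis lipschitz_bs_def mult_zero_right)
qed

lemma lipschitz_bs_zero: "lipschitz_bs (\<lambda>x. 0)"
  unfolding lipschitz_bs_def by (auto intro: exI[of _ 0])

lemma lipschitz_bs_continuous: "lipschitz_bs f \<Longrightarrow> continuous_on UNIV f"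
proof -
  assume "lipschitz_bs f"
  then obtain L where L: "\<And>x y. cmod (f x - f y) \<le> L * dist x y" by (auto simp: lipschitz_bs_def)
  have "\<bar>L\<bar>-lipschitz_on UNIV f"
  proof (rule lipschitz_onI)
    fix x y
    show "dist (f x) (f y) \<le> \<bar>L\<bar> * dist x y"
      using L[of x y] mult_right_mono[OF abs_ge_self, of "dist x y" L] by (simp add: dist_norm)
  qed simp
  then show ?thesis by (rule lipschitz_on_continuous_on)
qed

locale proper_measure =
  fixes M :: "'a::metric_space measure"
  assumes sets_M: "sets M = sets borel"
    and proper: "compact (cball (x::'a) r)"
    and noncompact: "\<not> compact (UNIV :: 'a set)"
    and ball_volume: "\<exists>C. \<forall>x. emeasure M (cball x r) \<le> ennreal C"
    and outer_regular: "A \<in> sets borel \<Longrightarrow> emeasure M A = (INF U\<in>{U. open U \<and> A \<subseteq> U}. emeasure M U)"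
begin

lemma space_M [simp]: "space M = UNIV"
  using sets_eq_imp_space_eq[OF sets_M] by simp

lemma measurable_M [simp]: "measurable M N = measurable borel N"
  by (rule measurable_cong_sets[OF sets_M refl])

lemma open_in_sets [simp]: "open A \<Longrightarrow> A \<in> sets M" and closed_in_sets [simp]: "closed A \<Longrightarrow> A \<in> sets M"
  by (auto simp: sets_M)

lemma cball_finite: "emeasure M (cball x r) < \<infinity>"
proof -
  obtain C where "emeasure M (cball x r) \<le> ennreal C" using ball_volume by blast
  also have "\<dots> < \<infinity>" by simp
  finally show ?thesis .
qed

lemma bounded_finite:
  assumes "A \<subseteq> cball p r"
  shows "emeasure M A < \<infinity>"
  using emeasure_mono[OF assms, of M] cball_finite[of p r] by (simp add: le_less_trans)

lemma is_L2_bounded_support: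
  assumes "f \<in> borel_measurable borel" "\<And>x. cmod (f x) \<le> B" "\<And>x. R < dist p x \<Longrightarrow> f x = 0"
  shows "is_L2 M f"
proof -
  have "integrable M (indicator (cball p R) :: 'a \<Rightarrow> real)"
    using cball_finite by (intro integrable_real_indicator) auto
  then have "is_L2 M (\<lambda>x. of_real (indicator (cball p R) x))"
  proof -
    assume int: "integrable M (indicator (cball p R) :: 'a \<Rightarrow> real)"
    have "(\<lambda>x. (cmod (complex_of_real (indicator (cball p R) x)))\<^sup>2) = indicator (cball p R)"
      by (auto simp: indicator_def)
    with int show ?thesis unfolding is_L2_def by auto
  qed
  then have "is_L2 M (\<lambda>x. of_real B * of_real (indicator (cball p R) x))" by (rule is_L2_cmult)
  then show ?thesis
  proof (rule is_L2_dominated)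
    show "AE x in M. cmod (f x) \<le> cmod (complex_of_real B * complex_of_real (indicator (cball p R) x))"
    proof (rule AE_I2)
      fix x
      have "cmod (f x) \<le> \<bar>B\<bar>" using assms(2)[of x] by simp
      then show "cmod (f x) \<le> cmod (complex_of_real B * complex_of_real (indicator (cball p R) x))"
        using assms(3)[of x] by (auto simp: indicator_def norm_mult)
    qed
  qed (use assms in auto)
qed

lemma lipschitz_bs_measurable: "lipschitz_bs h \<Longrightarrow> h \<in> borel_measurable borel"
  by (intro borel_measurable_continuous_onI lipschitz_bs_continuous)

lemma lipschitz_bs_L2:
  assumes "lipschitz_bs h" shows "is_L2 M h"
proof -
  \<comment> \<open>Any centre serves; \<open>undefined\<close> is merely an inhabitant of the
    type.\<close>
  obtain B R where "\<And>x. cmod (h x) \<le> B" "\<And>x. R < dist undefined x \<Longrightarrow> h x = 0"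
    using assms unfolding lipschitz_bs_def by metis
  then show ?thesis by (intro is_L2_bounded_support lipschitz_bs_measurable assms)
qed

definition approximable :: "('a \<Rightarrow> complex) \<Rightarrow> bool" where
  "approximable f \<longleftrightarrow> (\<forall>e>0. \<exists>h. lipschitz_bs h \<and> l2norm M (\<lambda>x. f x - h x) < e)"

lemma approximable_limit:
  assumes "is_L2 M f" "\<And>e. e > 0 \<Longrightarrow> \<exists>g. is_L2 M g \<and> approximable g \<and> l2norm M (\<lambda>x. f x - g x) < e"
  shows "approximable f"
  unfolding approximable_def
proof (intro allI impI)
  fix e :: real assume "e > 0"
  then have e2: "e / 2 > 0" by simp
  obtain g where g: "is_L2 M g" "approximable g" "l2norm M (\<lambda>x. f x - g x) < e / 2"
    using assms(2)[OF e2] by auto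
  obtain h where h: "lipschitz_bs h" "l2norm M (\<lambda>x. g x - h x) < e / 2"
    using g(2) e2 unfolding approximable_def by blast
  show "\<exists>h. lipschitz_bs h \<and> l2norm M (\<lambda>x. f x - h x) < e"
    using l2norm_diff_triangle[OF assms(1) g(1) lipschitz_bs_L2[OF h(1)]] g h
    by (intro exI[of _ h]) auto
qed

lemma approximable_lincomb:
  assumes f: "is_L2 M f" "approximable f" and g: "is_L2 M g" "approximable g"
  shows "approximable (\<lambda>x. f x + c * g x)"
  unfolding approximable_def
proof (intro allI impI)
  fix e :: real assume e: "e > 0"
  obtain h where h: "lipschitz_bs h" "l2norm M (\<lambda>x. f x - h x) < e / 2"
    using f(2) e unfolding approximable_def by (meson half_gt_zero)
  have "e / (2 * (cmod c + 1)) > 0" using e by (intro divide_pos_pos mult_pos_pos add_nonneg_pos) auto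
  then obtain k where k: "lipschitz_bs k" "l2norm M (\<lambda>x. g x - k x) < e / (2 * (cmod c + 1))"
    using g(2) unfolding approximable_def by meson
  note hL = lipschitz_bs_L2[OF h(1)] note kL = lipschitz_bs_L2[OF k(1)]
  have "l2norm M (\<lambda>x. (f x - h x) + c * (g x - k x)) \<le> l2norm M (\<lambda>x. f x - h x) + cmod c * l2norm M (\<lambda>x. g x - k x)"
    using l2norm_triangle[OF is_L2_diff[OF f(1) hL] is_L2_cmult[OF is_L2_diff[OF g(1) kL], of c]]
    by (simp only: l2norm_cmult)
  also have "cmod c * l2norm M (\<lambda>x. g x - k x) \<le> (cmod c + 1) * (e / (2 * (cmod c + 1)))"
    using k by (intro mult_mono) auto
  also have "(cmod c + 1) * (e / (2 * (cmod c + 1))) = e / 2"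
    by (simp add: field_simps add_nonneg_eq_0_iff)
  finally have "l2norm M (\<lambda>x. (f x - h x) + c * (g x - k x)) < e" using h(2) by simp
  then show "\<exists>h. lipschitz_bs h \<and> l2norm M (\<lambda>x. f x + c * g x - h x) < e"
    by (intro exI[of _ "\<lambda>x. h x + c * k x"] conjI lipschitz_bs_add lipschitz_bs_cmult h k)
      (simp add: algebra_simps)
qed

lemma approximable_sum:
  "(\<And>i. i \<in> I \<Longrightarrow> is_L2 M (f i) \<and> approximable (f i)) \<Longrightarrow> approximable (\<lambda>x. \<Sum>i\<in>I. c i * f i x)"
proof (induction I rule: infinite_finite_induct)
  case (insert i I)
  have "approximable (\<lambda>x. (\<Sum>j\<in>I. c j * f j x) + c i * f i x)"
    using insert by (intro approximable_lincomb is_L2_sum is_L2_cmult) auto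
  then show ?case using insert by (simp add: add.commute)
qed (auto simp: approximable_def intro!: exI[of _ "\<lambda>x. 0"] lipschitz_bs_zero)

text \<open>For open \<open>V\<close> the functions \<open>min 1 (n * infdist x (- V))\<close> are
  \<open>n\<close>-Lipschitz, vanish off \<open>V\<close> and converge pointwise to its
  indicator.\<close>

lemma approximable_indicator_open:
  assumes V: "open V" "V \<subseteq> cball p R"
  shows "approximable (indicator V)"
  unfolding approximable_def
proof (intro allI impI)
  fix e :: real assume e: "e > 0"
  \<comment> \<open>\<open>infdist\<close> to the empty set is \<open>0\<close>, so \<open>V\<close>
    must not be the whole space; noncompactness ensures this, balls being compact.\<close>
  have ne: "- V \<noteq> {}"
  proof
    assume "- V = {}"
    then have "UNIV = cball p R" using V by auto
    then show False using proper[of p R] noncompact by simp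
  qed
  define h where "h = (\<lambda>n x. complex_of_real (min 1 (real n * infdist x (- V))))"
  have h01: "0 \<le> min 1 (real n * infdist x (- V))" for n x by (simp add: infdist_nonneg)
  have hV: "h n x = 0" if "x \<notin> V" for n x using that by (simp add: h_def)
  have h1: "cmod (h n x) \<le> 1" for n x using h01[of n x] by (simp add: h_def del: of_real_mult)
  have lip: "cmod (h n x - h n y) \<le> real n * dist x y" for n x y
  proof -
    have "\<bar>real n * infdist x (- V) - real n * infdist y (- V)\<bar> \<le> real n * dist x y"
      using infdist_triangle_abs[of x "- V" y] by (simp add: abs_mult mult_left_mono flip: right_diff_distrib)
    then have "\<bar>min 1 (real n * infdist x (- V)) - min 1 (real n * infdist y (- V))\<bar> \<le> real n * dist x y"
      by linarith
    then show ?thesis unfolding h_def by (simp flip: of_real_diff del: of_real_mult)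
  qed
  have bs: "lipschitz_bs (h n)" for n
    unfolding lipschitz_bs_def
  proof (intro conjI allI)
    fix q
    show "\<exists>R. \<forall>x. R < dist q x \<longrightarrow> h n x = 0"
    proof (intro exI allI impI)
      fix x assume "dist q p + R < dist q x"
      then have "x \<notin> cball p R" using dist_triangle[of q x p] by auto
      then have "x \<notin> V" using V by blast
      then show "h n x = 0" by (rule hV)
    qed
  qed (use lip h1 in blast)+
  have VL: "is_L2 M (indicator V)"
    using V by (intro is_L2_bounded_support[where B=1 and R=R and p=p])
      (auto simp: indicator_def)
  have "(\<lambda>n. l2norm M (\<lambda>x. h n x - indicator V x)) \<longlonglongrightarrow> 0"
  proof (rule l2norm_dominated_convergence[OF VL])
    show "(\<lambda>n. h n x) \<longlonglongrightarrow> indicator V x" for x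
    proof (cases "x \<in> V")
      case True
      then have pos: "infdist x (- V) > 0"
        using V ne by (intro infdist_pos_not_in_closed) auto
      obtain N :: nat where N: "1 / infdist x (- V) < N" using reals_Archimedean2 by blast
      have "h n x = 1" if "N \<le> n" for n
      proof -
        have "1 / infdist x (- V) \<le> real n" using N that by linarith
        then have "1 \<le> real n * infdist x (- V)" using pos by (simp add: field_simps)
        then show ?thesis by (simp add: h_def)
      qed
      then have "eventually (\<lambda>n. h n x = 1) sequentially" by (auto simp: eventually_sequentially)
      then show ?thesis using True by (simp add: tendsto_eventually)
    qed (simp add: hV)
    show "cmod (h n x) \<le> cmod (indicator V x)" for n x
      using h1 hV by (cases "x \<in> V") auto
  qed (use V bs lipschitz_bs_measurable in auto)
  from order_tendstoD(2)[OF this e] obtain n where "l2norm M (\<lambda>x. h n x - indicator V x) < e"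
    by (auto simp: eventually_sequentially)
  then show "\<exists>h. lipschitz_bs h \<and> l2norm M (\<lambda>x. indicator V x - h x) < e"
    using bs by (subst l2norm_minus_commute) blast
qed

text \<open>Outer regularity encloses \<open>A\<close> in an open set with excess measure below
  \<open>e\<^sup>2\<close>; the distance of the two indicators is the square root of the
  excess.\<close>

lemma approximable_indicator:
  assumes A: "A \<in> sets borel" "A \<subseteq> ball p R"
  shows "is_L2 M (indicator A)" "approximable (indicator A)"
proof -
  show AL: "is_L2 M (indicator A)"
    using A by (intro is_L2_bounded_support[where B=1 and R=R and p=p]) (auto simp: indicator_def)
  show "approximable (indicator A)"
  proof (rule approximable_limit[OF AL])
    fix e :: real assume e: "e > 0"
    have fin: "emeasure M A < \<infinity>" using A by (intro bounded_finite[of A p R]) auto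
    have "(INF U\<in>{U. open U \<and> A \<subseteq> U}. emeasure M U) < emeasure M A + ennreal (e\<^sup>2)"
      unfolding outer_regular[OF A(1), symmetric] using fin e by (simp add: ennreal_less_zero_iff)
    then obtain U where U: "open U" "A \<subseteq> U" "emeasure M U < emeasure M A + ennreal (e\<^sup>2)"
      by (auto simp: INF_less_iff)
    \<comment> \<open>The open case requires a bounded set; cutting with \<open>ball p R\<close>
      loses nothing of \<open>A\<close>.\<close>
    define V where "V = U \<inter> ball p R"
    have V: "open V" "A \<subseteq> V" "V \<subseteq> cball p R" using U A by (auto simp: V_def)
    have AM: "A \<in> sets M" using A by (simp add: sets_M)
    have VL: "is_L2 M (indicator V)"
      using V by (intro is_L2_bounded_support[where B=1 and R=R and p=p]) (auto simp: indicator_def)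
    have "emeasure M A + emeasure M (V - A) = emeasure M (A \<union> (V - A))"
      using AM V by (intro plus_emeasure) auto
    also have "\<dots> \<le> emeasure M U"
      using U V by (intro emeasure_mono) (auto simp: V_def)
    also note U(3)
    finally have small: "emeasure M (V - A) < ennreal (e\<^sup>2)"
      by (simp add: ennreal_add_left_cancel_less)
    have "l2norm M (\<lambda>x. indicator A x - indicator V x) = sqrt (measure M (V - A))"
    proof -
      have "(cmod (indicator A x - indicator V x))\<^sup>2 = indicator (V - A) x" for x
        using V(2) by (auto simp: indicator_def)
      then show ?thesis unfolding l2norm_def by simp
    qed
    also have "measure M (V - A) < e\<^sup>2"
      using small order.strict_trans[OF small ennreal_less_top]
      by (simp add: emeasure_eq_ennreal_measure ennreal_less_iff)
    then have "sqrt (measure M (V - A)) < sqrt (e\<^sup>2)" by (rule real_sqrt_less_mono)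
    also have "sqrt (e\<^sup>2) = e" using e by simp
    finally show "\<exists>g. is_L2 M g \<and> approximable g \<and> l2norm M (\<lambda>x. indicator A x - g x) < e"
      using VL approximable_indicator_open[OF V(1,3)] by blast
  qed
qed

lemma L2_approximable:
  assumes f: "is_L2 M f"
  shows "approximable f"
proof (rule approximable_limit[OF f])
  fix e :: real assume e: "e > 0"
  have fm: "f \<in> borel_measurable M" using f by (simp add: is_L2_def)
  obtain s where s: "\<And>i. simple_function M (s i)" "\<And>x. (\<lambda>i. s i x) \<longlonglongrightarrow> f x"
    "\<And>i x. cmod (s i x) \<le> 2 * cmod (f x)"
    using borel_measurable_implies_sequence_metric[OF fm, of 0] by auto
  define p :: 'a where "p = undefined"
  \<comment> \<open>Truncation to growing balls makes the level sets bounded, as the indicator case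
    demands, and leaves the pointwise limit unchanged.\<close>
  define t where "t = (\<lambda>i x. indicator (ball p (real i)) x * s i x)"
  have sm: "s i \<in> borel_measurable M" for i by (rule borel_measurable_simple_function[OF s(1)])
  have tm: "t i \<in> borel_measurable M" for i
    unfolding t_def using sm by (intro borel_measurable_times borel_measurable_indicator) auto
  have tb: "cmod (t i x) \<le> cmod (2 * f x)" for i x
    using s(3)[of i x] by (simp add: t_def indicator_def norm_mult)
  have wL: "is_L2 M (\<lambda>x. 2 * f x)" using f by (rule is_L2_cmult)
  have tL: "is_L2 M (t i)" for i
    using wL tm by (rule is_L2_dominated) (use tb in auto)
  have "(\<lambda>i. l2norm M (\<lambda>x. t i x - f x)) \<longlonglongrightarrow> 0"
  proof (rule l2norm_dominated_convergence[OF wL tm fm _ tb])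
    fix x
    obtain N :: nat where N: "dist p x < N" using reals_Archimedean2 by blast
    have "eventually (\<lambda>i. s i x = t i x) sequentially"
      using N by (intro eventually_sequentiallyI[of N]) (auto simp: t_def indicator_def)
    then show "(\<lambda>i. t i x) \<longlonglongrightarrow> f x"
      using s(2)[of x] by (rule Lim_transform_eventually[rotated])
  qed
  from order_tendstoD(2)[OF this e] obtain i where i: "l2norm M (\<lambda>x. t i x - f x) < e"
    by (auto simp: eventually_sequentially)
  have "approximable (t i)"
  proof -
    let ?A = "\<lambda>v. s i -` {v} \<inter> ball p (real i)"
    have fin: "finite (range (s i))" using s(1)[of i] by (simp add: simple_function_def)
    have A: "?A v \<in> sets borel" for v
      using measurable_sets[OF sm[of i], of "{v}"] by (simp add: sets_M)
    have "t i = (\<lambda>x. \<Sum>v\<in>range (s i). v * indicator (?A v) x)"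
    proof
      fix x
      have "(\<Sum>v\<in>range (s i). v * indicator (?A v) x) = (\<Sum>v\<in>range (s i). if v = s i x then v * indicator (ball p (real i)) x else 0)"
        by (intro sum.cong) (auto simp: indicator_def)
      also have "\<dots> = t i x" using fin by (simp add: t_def)
      finally show "t i x = (\<Sum>v\<in>range (s i). v * indicator (?A v) x)" ..
    qed
    moreover have "approximable (\<lambda>x. \<Sum>v\<in>range (s i). v * indicator (?A v) x)"
      using approximable_indicator[OF A Int_lower2] by (intro approximable_sum) blast
    ultimately show ?thesis by simp
  qed
  then show "\<exists>g. is_L2 M g \<and> approximable g \<and> l2norm M (\<lambda>x. f x - g x) < e"
    using tL i by (subst l2norm_minus_commute) blast
qed

end

subsection \<open>Compact operators are limits of finite-rank kernel operators\<close>

lemma good_kernel_zero: "good_kernel (\<lambda>x y. 0)"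
  unfolding good_kernel_def by (auto intro: exI[of _ 0] uniformly_continuous_on_const)

lemma good_kernel_add:
  assumes "good_kernel k" "good_kernel l"
  shows "good_kernel (\<lambda>x y. k x y + l x y)"
  unfolding good_kernel_def
proof (intro conjI)
  obtain B B' where B: "\<And>x y. cmod (k x y) \<le> B" "\<And>x y. cmod (l x y) \<le> B'"
    using assms by (auto simp: good_kernel_def)
  show "\<exists>B. \<forall>x y. cmod (k x y + l x y) \<le> B" using norm_triangle_mono[OF B] by blast
  obtain r r' where "\<And>x y. dist x y > r \<Longrightarrow> k x y = 0" "\<And>x y. dist x y > r' \<Longrightarrow> l x y = 0"
    using assms unfolding good_kernel_def by metis
  then show "\<exists>r. \<forall>x y. r < dist x y \<longrightarrow> k x y + l x y = 0"
    by (intro exI[of _ "max r r'"]) simp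
qed (use assms in \<open>auto simp: good_kernel_def intro: uniformly_continuous_on_add\<close>)

lemma good_kernel_sum:
  "(\<And>i. i \<in> I \<Longrightarrow> good_kernel (k i)) \<Longrightarrow> good_kernel (\<lambda>x y. \<Sum>i\<in>I. k i x y)"
  by (induction I rule: infinite_finite_induct) (auto intro: good_kernel_zero good_kernel_add)

lemma good_kernel_tensor:
  assumes "lipschitz_bs a" "lipschitz_bs b"
  shows "good_kernel (\<lambda>x y. a x * cnj (b y))"
  unfolding good_kernel_def
proof (intro conjI)
  obtain La Lb where L: "\<And>x y. cmod (a x - a y) \<le> La * dist x y" "\<And>x y. cmod (b x - b y) \<le> Lb * dist x y"
    using assms by (auto simp: lipschitz_bs_def)
  obtain A B where AB: "\<And>x. cmod (a x) \<le> A" "\<And>x. cmod (b x) \<le> B"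
    using assms by (auto simp: lipschitz_bs_def)
  have pos: "0 \<le> A" "0 \<le> B" using AB[of undefined] norm_ge_zero order_trans by blast+
  show "\<exists>B. \<forall>x y. cmod (a x * cnj (b y)) \<le> B"
    using AB pos by (intro exI[of _ "A * B"]) (auto simp: norm_mult intro!: mult_mono)
  have "(\<bar>La\<bar> * B + A * \<bar>Lb\<bar>)-lipschitz_on UNIV (\<lambda>p. a (fst p) * cnj (b (snd p)))"
  proof (rule lipschitz_onI)
    fix p q :: "'a \<times> 'a"
    have "cmod (a (fst p) - a (fst q)) \<le> \<bar>La\<bar> * dist p q"
      using L(1)[of "fst p" "fst q"] dist_fst_le[of p q]
      by (meson abs_ge_self abs_ge_zero mult_mono order_trans zero_le_dist)
    moreover have "cmod (b (snd p) - b (snd q)) \<le> \<bar>Lb\<bar> * dist p q"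
      using L(2)[of "snd p" "snd q"] dist_snd_le[of p q]
      by (meson abs_ge_self abs_ge_zero mult_mono order_trans zero_le_dist)
    moreover have "cmod (a (fst p) * cnj (b (snd p)) - a (fst q) * cnj (b (snd q)))
        \<le> cmod (a (fst p) - a (fst q)) * cmod (b (snd p)) + cmod (a (fst q)) * cmod (b (snd p) - b (snd q))"
    proof -
      have "a (fst p) * cnj (b (snd p)) - a (fst q) * cnj (b (snd q))
          = (a (fst p) - a (fst q)) * cnj (b (snd p)) + a (fst q) * cnj (b (snd p) - b (snd q))"
        by (simp add: algebra_simps)
      then show ?thesis by (metis complex_mod_cnj norm_mult norm_triangle_ineq)
    qed
    ultimately have "cmod (a (fst p) * cnj (b (snd p)) - a (fst q) * cnj (b (snd q)))
        \<le> (\<bar>La\<bar> * dist p q) * B + A * (\<bar>Lb\<bar> * dist p q)"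
      using AB pos by (smt (verit) mult_mono norm_ge_zero)
    then show "dist (a (fst p) * cnj (b (snd p))) (a (fst q) * cnj (b (snd q))) \<le> (\<bar>La\<bar> * B + A * \<bar>Lb\<bar>) * dist p q"
      by (simp add: dist_norm algebra_simps)
  qed (use pos in simp)
  then show "uniformly_continuous_on UNIV (\<lambda>p. a (fst p) * cnj (b (snd p)))"
    by (rule lipschitz_on_uniformly_continuous)
  obtain R S where RS: "\<And>x. R < dist undefined x \<Longrightarrow> a x = 0" "\<And>x. S < dist undefined x \<Longrightarrow> b x = 0"
    using assms unfolding lipschitz_bs_def by metis
  show "\<exists>r. \<forall>x y. r < dist x y \<longrightarrow> a x * cnj (b y) = 0"
  proof (intro exI allI impI)
    fix x y :: 'a assume "R + S < dist x y"
    \<comment> \<open>Points within \<open>R\<close> and \<open>S\<close> of the common centre would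
      be at most \<open>R + S\<close> apart.\<close>
    then have "R < dist undefined x \<or> S < dist undefined y"
      using dist_triangle3[of x y undefined] by linarith
    then show "a x * cnj (b y) = 0" using RS by auto
  qed
qed

lemma Op_finite_rank:
  assumes "\<And>i. i \<in> I \<Longrightarrow> is_L2 M (b i)" "is_L2 M f"
  shows "Op M (\<lambda>x y. \<Sum>i\<in>I. a i x * cnj (b i y)) f x = (\<Sum>i\<in>I. cip M (b i) f * a i x)"
proof -
  have "Op M (\<lambda>x y. \<Sum>i\<in>I. a i x * cnj (b i y)) f x = (\<integral>y. (\<Sum>i\<in>I. a i x * (cnj (b i y) * f y)) \<partial>M)"
    unfolding Op_def sum_distrib_right by (simp add: mult.assoc)
  also have "\<dots> = (\<Sum>i\<in>I. \<integral>y. a i x * (cnj (b i y) * f y) \<partial>M)"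
    using assms by (intro Bochner_Integration.integral_sum integrable_mult_right cip_integrable)
  finally show ?thesis by (simp add: cip_def mult.commute)
qed

lemma bounded_op_finite_rank:
  assumes a: "\<And>i. i \<in> I \<Longrightarrow> is_L2 M (a i)" and b: "\<And>i. i \<in> I \<Longrightarrow> is_L2 M (b i)"
  shows "bounded_op M (Op M (\<lambda>x y. \<Sum>i\<in>I. a i x * cnj (b i y)))"
proof (rule bounded_opI[where C="\<Sum>i\<in>I. l2norm M (b i) * l2norm M (a i)"])
  fix f g c assume fg: "is_L2 M f" "is_L2 M g"
  then have L: "is_L2 M (\<lambda>y. f y + c * g y)" by (intro is_L2_add is_L2_cmult)
  have "cip M (b i) (\<lambda>y. f y + c * g y) = cip M (b i) f + c * cip M (b i) g" if "i \<in> I" for i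
    using b[OF that] fg by (simp add: cip_add_right cip_cmult_right is_L2_cmult)
  then show "AE x in M. Op M (\<lambda>x y. \<Sum>i\<in>I. a i x * cnj (b i y)) (\<lambda>y. f y + c * g y) x
      = Op M (\<lambda>x y. \<Sum>i\<in>I. a i x * cnj (b i y)) f x + c * Op M (\<lambda>x y. \<Sum>i\<in>I. a i x * cnj (b i y)) g x"
    using L fg b by (simp add: Op_finite_rank sum_distrib_left algebra_simps flip: sum.distrib)
next
  fix f assume f: "is_L2 M f"
  have eq: "Op M (\<lambda>x y. \<Sum>i\<in>I. a i x * cnj (b i y)) f = (\<lambda>x. \<Sum>i\<in>I. cip M (b i) f * a i x)"
    using f b by (intro ext Op_finite_rank)
  show "is_L2 M (Op M (\<lambda>x y. \<Sum>i\<in>I. a i x * cnj (b i y)) f)"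
    unfolding eq by (intro is_L2_sum is_L2_cmult a)
  have "l2norm M (\<lambda>x. \<Sum>i\<in>I. cip M (b i) f * a i x) \<le> (\<Sum>i\<in>I. l2norm M (\<lambda>x. cip M (b i) f * a i x))"
    by (intro l2norm_sum_le is_L2_cmult a)
  also have "\<dots> \<le> (\<Sum>i\<in>I. (l2norm M (b i) * l2norm M f) * l2norm M (a i))"
    unfolding l2norm_cmult using b f by (intro sum_mono mult_right_mono cip_norm_le) auto
  finally show "l2norm M (Op M (\<lambda>x y. \<Sum>i\<in>I. a i x * cnj (b i y)) f)
      \<le> (\<Sum>i\<in>I. l2norm M (b i) * l2norm M (a i)) * l2norm M f"
    unfolding eq by (simp add: sum_distrib_left sum_distrib_right mult_ac)
qed

text \<open>One factor is exchanged at a time: the difference splits into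
  \<open>cip M v f * (u x - a x)\<close> and a term with coefficient
  \<open>cip M v f - cip M b f\<close> along \<open>a\<close>, each estimated by
  Cauchy-Schwarz.\<close>

lemma rank_one_perturbation:
  assumes L2: "is_L2 M u" "is_L2 M v" "is_L2 M a" "is_L2 M b" "is_L2 M f"
  shows "l2norm M (\<lambda>x. cip M v f * u x - cip M b f * a x)
    \<le> (l2norm M v * l2norm M (\<lambda>x. u x - a x) + l2norm M (\<lambda>x. v x - b x) * l2norm M a) * l2norm M f"
proof -
  have vb: "is_L2 M (\<lambda>x. v x - b x)" and ua: "is_L2 M (\<lambda>x. u x - a x)"
    using L2 by (auto intro: is_L2_diff)
  have "cip M (\<lambda>x. v x - b x) f = cip M v f - cip M b f"
    using cip_diff_right[of M f v b] L2 by (simp add: cip_commute[of M _ f])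
  then have b: "cip M b f = cip M v f - cip M (\<lambda>x. v x - b x) f" by simp
  have "l2norm M (\<lambda>x. cip M v f * u x - cip M b f * a x)
      = l2norm M (\<lambda>x. cip M v f * (u x - a x) + cip M (\<lambda>x. v x - b x) f * a x)"
    by (subst b) (simp add: algebra_simps)
  also have "\<dots> \<le> l2norm M (\<lambda>x. cip M v f * (u x - a x)) + l2norm M (\<lambda>x. cip M (\<lambda>x. v x - b x) f * a x)"
    by (intro l2norm_triangle is_L2_cmult ua L2)
  also have "\<dots> \<le> (l2norm M v * l2norm M f) * l2norm M (\<lambda>x. u x - a x)
      + (l2norm M (\<lambda>x. v x - b x) * l2norm M f) * l2norm M a"
    unfolding l2norm_cmult by (intro add_mono mult_right_mono cip_norm_le L2 vb) auto
  finally show ?thesis by (simp add: algebra_simps)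
qed

context proper_measure
begin

text \<open>Composing \<open>T\<close> with the projection onto the \<open>v i\<close> changes it by
  at most \<open>e / 4\<close>, and the composition has kernel
  \<open>\<Sum>i<n. T (v i) x * cnj (v i y)\<close>. This need not be continuous or controlled, so
  \<open>T (v i)\<close> and \<open>v i\<close> are replaced by Lipschitz functions of bounded
  support.\<close>

lemma compact_op_in_E:
  assumes T: "compact_op M T"
  shows "in_E M T"
  unfolding in_E_def
proof (intro conjI allI impI)
  show bT: "bounded_op M T" using T by (simp add: compact_op_def)
  obtain C where C: "0 \<le> C" "\<And>f. is_L2 M f \<Longrightarrow> l2norm M (T f) \<le> C * l2norm M f"
    using bounded_op_bound[OF bT] by metis
  fix e :: real assume e: "0 < e"
  then have "e / 4 > 0" by simp
  from compact_op_small_on_complement[OF T this]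
  obtain n and v :: "nat \<Rightarrow> 'a \<Rightarrow> complex" where v: "orthonormal_on M {..<n} v"
    and small: "\<forall>g. is_L2 M g \<longrightarrow> (\<forall>i<n. cip M (v i) g = 0) \<longrightarrow> l2norm M (T g) \<le> e / 4 * l2norm M g"
    by blast
  have vL: "is_L2 M (v i)" and vn: "l2norm M (v i) = 1" if "i < n" for i
    using orthonormal_onD[OF v] that by auto
  have TvL: "is_L2 M (T (v i))" if "i < n" for i using bounded_op_L2[OF bT vL[OF that]] .
  \<comment> \<open>Each of the \<open>n\<close> terms will be off by at most
    \<open>\<eta> * (1 + (C + 1))\<close>. The cap \<open>1\<close> gives
    \<open>l2norm M (a i) \<le> C + 1\<close>, and \<open>n + 1\<close> covers
    \<open>n = 0\<close>.\<close>
  define \<eta> where "\<eta> = min 1 (e / (4 * (real n + 1) * (2 + C)))"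
  have \<eta>: "0 < \<eta>" "\<eta> \<le> 1" "\<eta> \<le> e / (4 * (real n + 1) * (2 + C))"
    using e C by (auto simp: \<eta>_def)
  have n\<eta>: "real n * (\<eta> * (2 + C)) \<le> e / 4"
  proof -
    have "real n * (\<eta> * (2 + C)) \<le> (real n + 1) * (e / (4 * (real n + 1) * (2 + C)) * (2 + C))"
      using \<eta> C by (intro mult_mono) auto
    also have "\<dots> = e / 4"
    proof -
      have "N * (e / (4 * N * D) * D) = e / 4" if "0 < N" "0 < D" for N D :: real
        using that by (simp add: field_simps)
      from this[of "real n + 1" "2 + C"] C show ?thesis by simp
    qed
    finally show ?thesis .
  qed
  have "\<exists>a. lipschitz_bs a \<and> l2norm M (\<lambda>x. T (v i) x - a x) < \<eta>" if "i < n" for i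
    using L2_approximable[OF TvL[OF that]] \<eta>(1) by (auto simp: approximable_def)
  then obtain a where a: "\<And>i. i < n \<Longrightarrow> lipschitz_bs (a i)" "\<And>i. i < n \<Longrightarrow> l2norm M (\<lambda>x. T (v i) x - a i x) < \<eta>"
    by metis
  have "\<exists>b. lipschitz_bs b \<and> l2norm M (\<lambda>x. v i x - b x) < \<eta>" if "i < n" for i
    using L2_approximable[OF vL[OF that]] \<eta>(1) by (auto simp: approximable_def)
  then obtain b where b: "\<And>i. i < n \<Longrightarrow> lipschitz_bs (b i)" "\<And>i. i < n \<Longrightarrow> l2norm M (\<lambda>x. v i x - b i x) < \<eta>"
    by metis
  have aL: "is_L2 M (a i)" and bL: "is_L2 M (b i)" if "i < n" for i
    using a b that lipschitz_bs_L2 by auto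
  have an: "l2norm M (a i) \<le> C + 1" if "i < n" for i
    using l2norm_triangle_sub[OF aL[OF that] TvL[OF that]] a(2)[OF that] C(2)[OF vL[OF that]] vn[OF that] \<eta>(2)
    by (simp add: l2norm_minus_commute[of M "a i"])
  define k where "k = (\<lambda>x y. \<Sum>i<n. a i x * cnj (b i y))"
  have k: "good_kernel k" unfolding k_def using a b by (intro good_kernel_sum good_kernel_tensor) auto
  have bk: "bounded_op M (Op M k)" unfolding k_def using aL bL by (intro bounded_op_finite_rank) auto
  have "opnorm M (\<lambda>f x. T f x - Op M k f x) \<le> e / 2"
  proof (rule opnorm_le)
    fix f assume f: "is_L2 M f" "l2norm M f \<le> 1"
    \<comment> \<open>\<open>?p\<close> is the projection of \<open>f\<close>, \<open>?q\<close>
      represents \<open>T ?p\<close>, and \<open>?g\<close> is the part of \<open>f\<close> on which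
      \<open>T\<close> is small.\<close>
    let ?p = "\<lambda>x. \<Sum>i<n. cip M (v i) f * v i x"
    let ?q = "\<lambda>x. \<Sum>i<n. cip M (v i) f * T (v i) x"
    let ?g = "\<lambda>x. f x - ?p x"
    have g: "is_L2 M ?g" "\<And>i. i < n \<Longrightarrow> cip M (v i) ?g = 0" "l2norm M ?g \<le> l2norm M f"
      using orthonormal_residual[OF _ v f(1)] by auto
    have pL: "is_L2 M ?p" using vL by (intro is_L2_sum is_L2_cmult) auto
    have qL: "is_L2 M ?q" using TvL by (intro is_L2_sum is_L2_cmult) auto
    have TfL: "is_L2 M (T f)" and TgL: "is_L2 M (T ?g)" using bounded_op_L2[OF bT] f(1) g(1) by blast+
    have kL: "is_L2 M (Op M k f)" by (rule bounded_op_L2[OF bk f(1)])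
    have "AE x in M. T (\<lambda>y. ?g y + 1 * ?p y) x = T ?g x + 1 * T ?p x"
      by (rule bounded_op_linear_AE[OF bT g(1) pL])
    moreover have "AE x in M. T ?p x = ?q x"
      using vL by (intro bounded_op_sum_AE[OF bT]) auto
    ultimately have "AE x in M. T f x - ?q x = T ?g x" by eventually_elim simp
    then have "l2norm M (\<lambda>x. T f x - ?q x) = l2norm M (T ?g)"
      using is_L2_diff[OF TfL qL] TgL by (intro l2norm_cong_AE is_L2_measurable)
    also have "\<dots> \<le> e / 4 * l2norm M ?g" using g small by blast
    also have "\<dots> \<le> e / 4 * 1" using g(3) f(2) e by (intro mult_left_mono) auto
    finally have 1: "l2norm M (\<lambda>x. T f x - ?q x) \<le> e / 4" by simp
    have "l2norm M (\<lambda>x. ?q x - Op M k f x) = l2norm M (\<lambda>x. \<Sum>i<n. cip M (v i) f * T (v i) x - cip M (b i) f * a i x)"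
      unfolding k_def using bL f by (subst Op_finite_rank) (auto simp: sum_subtractf)
    also have "\<dots> \<le> (\<Sum>i<n. l2norm M (\<lambda>x. cip M (v i) f * T (v i) x - cip M (b i) f * a i x))"
      using aL TvL by (intro l2norm_sum_le is_L2_diff is_L2_cmult) auto
    also have "\<dots> \<le> (\<Sum>i<n. \<eta> * (2 + C))"
    proof (rule sum_mono)
      fix i assume "i \<in> {..<n}"
      then have i: "i < n" by simp
      have "l2norm M (\<lambda>x. cip M (v i) f * T (v i) x - cip M (b i) f * a i x)
          \<le> (l2norm M (v i) * l2norm M (\<lambda>x. T (v i) x - a i x) + l2norm M (\<lambda>x. v i x - b i x) * l2norm M (a i)) * l2norm M f"
        by (intro rank_one_perturbation TvL vL aL bL i f)
      also have "\<dots> \<le> (1 * \<eta> + \<eta> * (C + 1)) * 1"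
        using vn[OF i] a(2)[OF i] b(2)[OF i] an[OF i] f(2) C \<eta>
        by (intro mult_mono add_mono) auto
      finally show "l2norm M (\<lambda>x. cip M (v i) f * T (v i) x - cip M (b i) f * a i x) \<le> \<eta> * (2 + C)"
        by (simp add: algebra_simps)
    qed
    also have "\<dots> \<le> e / 4" using n\<eta> by simp
    finally have 2: "l2norm M (\<lambda>x. ?q x - Op M k f x) \<le> e / 4" .
    show "l2norm M (\<lambda>x. T f x - Op M k f x) \<le> e / 2"
      using l2norm_diff_triangle[OF TfL qL kL] 1 2 by simp
  qed
  then have "opnorm M (\<lambda>f x. T f x - Op M k f x) < e" using e by simp
  then show "\<exists>k. good_kernel k \<and> bounded_op M (Op M k) \<and> opnorm M (\<lambda>f x. T f x - Op M k f x) < e"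
    using k bk by blast
qed

text \<open>Vanishing at infinity is inherited from a finite net of the image of the unit ball: the
  net points are close to functions of bounded support, and a ball \<open>cball x r\<close> far
  enough out misses all these supports.\<close>

lemma compact_op_imp_in_G:
  assumes T: "compact_op M T"
  shows "in_G M T"
  unfolding in_G_def
proof (intro conjI allI impI)
  show "in_E M T" by (rule compact_op_in_E[OF T])
  have bT: "bounded_op M T" using T by (simp add: compact_op_def)
  fix r e :: real assume r: "0 < r" and e: "0 < e"
  have "e / 4 > 0" using e by simp
  then have "\<exists>F. finite F \<and> (\<forall>g\<in>F. is_L2 M g) \<and>
      (\<forall>f. is_L2 M f \<and> l2norm M f \<le> 1 \<longrightarrow> (\<exists>g\<in>F. l2norm M (\<lambda>x. T f x - g x) < e / 4))"
    using T unfolding compact_op_def by blast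
  then obtain F where F: "finite F" "\<And>g. g \<in> F \<Longrightarrow> is_L2 M g"
    "\<And>f. is_L2 M f \<Longrightarrow> l2norm M f \<le> 1 \<Longrightarrow> \<exists>g\<in>F. l2norm M (\<lambda>x. T f x - g x) < e / 4"
    by blast
  have "\<forall>g\<in>F. \<exists>h. lipschitz_bs h \<and> l2norm M (\<lambda>x. g x - h x) < e / 4"
    using L2_approximable F(2) \<open>e / 4 > 0\<close> unfolding approximable_def by blast
  then obtain h where h: "\<And>g. g \<in> F \<Longrightarrow> lipschitz_bs (h g)"
    "\<And>g. g \<in> F \<Longrightarrow> l2norm M (\<lambda>x. g x - h g x) < e / 4"
    by metis
  define p :: 'a where "p = undefined"
  have "\<forall>g\<in>F. \<exists>R. \<forall>x. R < dist p x \<longrightarrow> h g x = 0"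
    using h(1) by (auto simp: lipschitz_bs_def)
  then obtain R where R: "\<And>g x. g \<in> F \<Longrightarrow> R g < dist p x \<Longrightarrow> h g x = 0" by metis
  obtain S where S: "\<And>g. g \<in> F \<Longrightarrow> R g \<le> S"
    using finite_imageI[OF F(1), of R] by (metis bdd_above.E bdd_above_finite image_eqI)
  show "\<exists>K. compact K \<and> (\<forall>x. x \<notin> K \<longrightarrow> opnorm M (\<lambda>f y. indicator (cball x r) y * T f y) < e)"
  proof (intro exI[of _ "cball p (S + r)"] conjI allI impI)
    \<comment> \<open>By the triangle inequality \<open>cball x r\<close> is then disjoint from
      \<open>cball p S\<close>, which contains all the supports.\<close>
    fix x assume x: "x \<notin> cball p (S + r)"
    let ?i = "indicator (cball x r) :: 'a \<Rightarrow> complex"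
    have im: "?i \<in> borel_measurable M" "\<And>x. cmod (?i x) \<le> 1"
      by (auto simp: indicator_def intro!: borel_measurable_indicator)
    have "opnorm M (\<lambda>f y. ?i y * T f y) \<le> e / 2"
    proof (rule opnorm_le)
      fix f assume f: "is_L2 M f" "l2norm M f \<le> 1"
      obtain g where g: "g \<in> F" "l2norm M (\<lambda>x. T f x - g x) < e / 4" using F(3)[OF f] by auto
      have hL: "is_L2 M (h g)" using h(1)[OF g(1)] by (rule lipschitz_bs_L2)
      note TL = bounded_op_L2[OF bT f(1)] note gL = F(2)[OF g(1)]
      have z: "?i y * h g y = 0" for y
      proof (cases "y \<in> cball x r")
        case True
        then have "S < dist p y" using x dist_triangle[of p x y] by (simp add: dist_commute)
        then show ?thesis using R[OF g(1), of y] S[OF g(1)] by simp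
      qed simp
      have "l2norm M (\<lambda>y. ?i y * T f y) = l2norm M (\<lambda>y. ?i y * (T f y - h g y))"
        by (simp only: right_diff_distrib z diff_zero)
      also have "\<dots> \<le> l2norm M (\<lambda>y. T f y - h g y)"
        by (intro is_L2_mult_le1 is_L2_diff TL hL im)
      also have "\<dots> \<le> e / 2"
        using l2norm_diff_triangle[OF TL gL hL] g h(2)[OF g(1)] by simp
      finally show "l2norm M (\<lambda>y. ?i y * T f y) \<le> e / 2" .
    qed
    then show "opnorm M (\<lambda>f y. ?i y * T f y) < e" using e by simp
  qed (rule proper)
qed

end

subsection \<open>Localisation of controlled operators\<close>

context proper_measure
begin

section \<open>Separability and joint measurability\<close>

lemma sigma_finite: "sigma_finite_measure M"
proof (rule sigma_finite_measure.intro, intro exI conjI ballI)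
  show "\<Union> (range (\<lambda>n. cball (undefined :: 'a) (real n))) = space M"
    using real_arch_simple by fastforce
  show "emeasure M a \<noteq> \<infinity>" if "a \<in> range (\<lambda>n. cball undefined (real n))" for a
  proof -
    from that obtain n :: nat where "a = cball undefined (real n)" by auto
    then show ?thesis using cball_finite[of undefined "real n"] by (simp add: less_top)
  qed
qed auto

text \<open>Compactness of balls implies separability: each ball of integer radius has finite nets
  of every mesh \<open>1 / (m + 1)\<close>.\<close>

lemma dense_sequence:
  obtains d :: "nat \<Rightarrow> 'a" where "\<And>x e. 0 < e \<Longrightarrow> \<exists>n. dist x (d n) < e"
proof -
  have "\<exists>k. finite k \<and> cball (undefined :: 'a) (real n) \<subseteq> (\<Union>x\<in>k. ball x (1 / real (Suc m)))" for n m
    using proper[of undefined "real n"] unfolding compact_eq_totally_bounded by simp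
  then obtain F where F: "\<And>n m. finite (F n m)"
    "\<And>n m. cball (undefined :: 'a) (real n) \<subseteq> (\<Union>x\<in>F n m. ball x (1 / real (Suc m)))"
    by metis
  define D where "D = (\<Union>n m. F n m)"
  have D: "countable D" unfolding D_def by (intro countable_UN) (auto intro: countable_finite F)
  have dense: "\<exists>y\<in>D. dist x y < e" if e: "0 < e" for x e
  proof -
    obtain n :: nat where "dist undefined x \<le> n" using real_arch_simple by blast
    moreover obtain m where m: "1 / real (Suc m) < e"
      using reals_Archimedean[OF e] by (auto simp: inverse_eq_divide)
    ultimately obtain y where "y \<in> F n m" "dist y x < 1 / real (Suc m)" using F(2)[of n m] by auto
    then show ?thesis using m by (intro bexI[of _ y]) (auto simp: D_def dist_commute)
  qed
  have "D \<noteq> {}" using dense[of 1] by auto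
  then have "range (from_nat_into D) = D" using D by (rule range_from_nat_into)
  then show ?thesis using dense by (intro that[of "from_nat_into D"]) (metis imageE)
qed

text \<open>Taking the first index makes the choice of a nearby point Borel with countably many
  values, so that measurability in \<open>x\<close> reduces to one fixed point at a time.\<close>

lemma measurable_nearby_index:
  fixes d :: "nat \<Rightarrow> 'a"
  shows "(\<lambda>x. LEAST n. dist x (d n) < e) \<in> measurable borel (count_space UNIV)"
proof (rule measurable_Least)
  fix n
  have "{x. dist x (d n) < e} = ball (d n) e" by (auto simp: dist_commute)
  then have "{x \<in> space borel. dist x (d n) < e} \<in> sets borel" by simp
  then show "Measurable.pred borel (\<lambda>x. dist x (d n) < e)" by (simp only: pred_def)
qed

text \<open>The space is separable but its type is not an instance of
  \<open>second_countable_topology\<close>, so joint measurability is obtained by discretising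
  the first variable.\<close>

lemma continuous_kernel_measurable:
  fixes k :: "'a \<Rightarrow> 'a \<Rightarrow> complex"
  assumes k: "continuous_on UNIV (\<lambda>p. k (fst p) (snd p))"
    and f: "f \<in> measurable N M" and g: "g \<in> measurable N M"
  shows "(\<lambda>w. k (f w) (g w)) \<in> borel_measurable N"
proof -
  obtain d :: "nat \<Rightarrow> 'a" where d: "\<And>x e. 0 < e \<Longrightarrow> \<exists>n. dist x (d n) < e"
    using dense_sequence by blast
  \<comment> \<open>As \<open>d (i m x)\<close> converges to \<open>x\<close>, continuity exhibits
    \<open>k\<close> as a pointwise limit of kernels that depend on the first variable only through
    a countable index.\<close>
  define i where "i = (\<lambda>m x. LEAST n. dist x (d n) < 1 / real (Suc m))"
  have near: "dist x (d (i m x)) < 1 / real (Suc m)" for m x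
    unfolding i_def by (rule LeastI_ex, rule d) simp
  have fb: "f \<in> measurable N borel" and gb: "g \<in> measurable N borel"
    using f g by (simp_all add: measurable_cong_sets[OF refl sets_M])
  have km: "k c \<in> borel_measurable borel" for c
  proof (rule borel_measurable_continuous_onI)
    have "continuous_on UNIV (\<lambda>y. (\<lambda>p. k (fst p) (snd p)) (c, y))"
      by (rule continuous_on_compose2[OF k]) (auto intro: continuous_intros)
    then show "continuous_on UNIV (k c)" by simp
  qed
  show ?thesis
  proof (rule borel_measurable_LIMSEQ_metric)
    fix m
    show "(\<lambda>w. k (d (i m (f w))) (g w)) \<in> borel_measurable N"
    proof (rule measurable_compose_countable[where f="\<lambda>n w. k (d n) (g w)" and g="\<lambda>w. i m (f w)"])
      show "(\<lambda>w. i m (f w)) \<in> measurable N (count_space UNIV)"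
        using measurable_compose[OF fb measurable_nearby_index] unfolding i_def .
    qed (rule measurable_compose[OF gb km])
  next
    fix w
    have "(\<lambda>m. dist (d (i m (f w))) (f w)) \<longlonglongrightarrow> 0"
    proof (rule tendsto_sandwich[OF _ _ tendsto_const LIMSEQ_inverse_real_of_nat])
      show "eventually (\<lambda>m. dist (d (i m (f w))) (f w) \<le> inverse (real (Suc m))) sequentially"
        using near by (intro always_eventually allI less_imp_le) (simp add: dist_commute inverse_eq_divide)
    qed simp
    then have "(\<lambda>m. d (i m (f w))) \<longlonglongrightarrow> f w" by (rule tendsto_dist_iff[THEN iffD2])
    then have "(\<lambda>m. (d (i m (f w)), g w)) \<longlonglongrightarrow> (f w, g w)" by (intro tendsto_intros)
    from continuous_on_tendsto_compose[OF k this]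
    show "(\<lambda>m. k (d (i m (f w))) (g w)) \<longlonglongrightarrow> k (f w) (g w)" by simp
  qed
qed

text \<open>The metric, taken as a complex kernel, is itself continuous.\<close>

lemma dist_measurable:
  assumes "f \<in> measurable N M" "g \<in> measurable N M"
  shows "(\<lambda>w. dist (f w) (g w)) \<in> borel_measurable N"
proof -
  have "(\<lambda>w. complex_of_real (dist (f w) (g w))) \<in> borel_measurable N"
    using assms by (intro continuous_kernel_measurable[where k="\<lambda>x y. complex_of_real (dist x y)"] continuous_intros)
  then have "(\<lambda>w. Re (complex_of_real (dist (f w) (g w)))) \<in> borel_measurable N" by measurable
  then show ?thesis by simp
qed

text \<open>Property A provides no joint measurability of \<open>\<phi>\<close> and bounds supports
  only almost everywhere. Replacing \<open>x\<close> by the first point of a dense sequence at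
  distance below \<open>1\<close> leaves countably many sections, hence a jointly measurable
  \<open>\<Phi>\<close>; cutting off outside a ball makes the support condition hold
  everywhere.\<close>

lemma property_A_discretised:
  assumes "property_A M" "0 < \<delta>" "0 \<le> r"
  obtains \<Phi> :: "'a \<Rightarrow> 'a \<Rightarrow> complex" and s where
    "(\<lambda>p. \<Phi> (fst p) (snd p)) \<in> borel_measurable (M \<Otimes>\<^sub>M M)"
    "\<And>x. (\<integral>\<^sup>+z. ennreal ((cmod (\<Phi> x z))\<^sup>2) \<partial>M) = 1"
    "\<And>x y. dist x y \<le> r \<Longrightarrow> (\<integral>\<^sup>+z. ennreal ((cmod (\<Phi> x z - \<Phi> y z))\<^sup>2) \<partial>M) \<le> ennreal (\<delta>\<^sup>2)"
    "\<And>x z. s < dist x z \<Longrightarrow> \<Phi> x z = 0" "0 < s"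
proof -
  \<comment> \<open>Two points at distance at most \<open>r\<close> will each be moved by less than
    \<open>1\<close>, hence \<open>r + 2\<close>.\<close>
  have "\<exists>(\<phi>::'a \<Rightarrow> 'a \<Rightarrow> complex) s.
     (\<forall>x. is_L2 M (\<phi> x) \<and> l2norm M (\<phi> x) = 1 \<and> (AE y in M. dist x y > s \<longrightarrow> \<phi> x y = 0)) \<and>
     (\<forall>g. is_L2 M g \<longrightarrow> (\<lambda>x. l2norm M (\<lambda>y. \<phi> x y - g y)) \<in> borel_measurable borel) \<and>
     (\<forall>x y. dist x y < r + 2 \<longrightarrow> l2norm M (\<lambda>z. \<phi> x z - \<phi> y z) < \<delta>)"
    using assms(1)[unfolded property_A_def, rule_format, OF assms(2), of "r + 2"] assms(3) by auto
  then obtain \<phi> :: "'a \<Rightarrow> 'a \<Rightarrow> complex" and s where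
    \<phi>: "\<And>x. is_L2 M (\<phi> x)" "\<And>x. l2norm M (\<phi> x) = 1"
      "\<And>x. AE y in M. dist x y > s \<longrightarrow> \<phi> x y = 0"
      "\<And>x y. dist x y < r + 2 \<Longrightarrow> l2norm M (\<lambda>z. \<phi> x z - \<phi> y z) < \<delta>"
    by blast
  obtain d :: "nat \<Rightarrow> 'a" where d: "\<And>x e. 0 < e \<Longrightarrow> \<exists>n. dist x (d n) < e"
    using dense_sequence by blast
  define i where "i = (\<lambda>x. LEAST n. dist x (d n) < 1)"
  have near: "dist x (d (i x)) < 1" for x unfolding i_def by (rule LeastI_ex, rule d) simp
  have im: "i \<in> measurable M (count_space UNIV)" using measurable_nearby_index[of d 1] by (simp add: i_def)
  define \<psi> where "\<psi> = (\<lambda>x z. indicator (cball x s) z * \<phi> x z)"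
  define \<Phi> where "\<Phi> = (\<lambda>x. \<psi> (d (i x)))"
  have \<psi>m: "\<psi> x \<in> borel_measurable M" for x
    unfolding \<psi>_def using \<phi>(1)[of x] by (intro borel_measurable_times borel_measurable_indicator) (auto simp: is_L2_def)
  have \<psi>\<phi>: "AE z in M. \<psi> x z = \<phi> x z" for x
    using \<phi>(3)[of x] by eventually_elim (auto simp: \<psi>_def indicator_def)
  show ?thesis
  proof (rule that)
    show "(\<lambda>p. \<Phi> (fst p) (snd p)) \<in> borel_measurable (M \<Otimes>\<^sub>M M)"
      unfolding \<Phi>_def
    proof (rule measurable_compose_countable[where f="\<lambda>n p. \<psi> (d n) (snd p)" and g="\<lambda>p. i (fst p)"])
      show "(\<lambda>p. \<psi> (d n) (snd p)) \<in> borel_measurable (M \<Otimes>\<^sub>M M)" for n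
        by (rule measurable_compose[OF measurable_snd \<psi>m])
      show "(\<lambda>p. i (fst p)) \<in> measurable (M \<Otimes>\<^sub>M M) (count_space UNIV)"
        by (rule measurable_compose[OF measurable_fst im])
    qed
    show "(\<integral>\<^sup>+z. ennreal ((cmod (\<Phi> x z))\<^sup>2) \<partial>M) = 1" for x
    proof -
      have "(\<integral>\<^sup>+z. ennreal ((cmod (\<Phi> x z))\<^sup>2) \<partial>M) = (\<integral>\<^sup>+z. ennreal ((cmod (\<phi> (d (i x)) z))\<^sup>2) \<partial>M)"
        unfolding \<Phi>_def using \<psi>\<phi>[of "d (i x)"] by (intro nn_integral_cong_AE) (auto elim: eventually_mono)
      then show ?thesis using nn_integral_l2norm[OF \<phi>(1)] \<phi>(2) by simp
    qed
    show "(\<integral>\<^sup>+z. ennreal ((cmod (\<Phi> x z - \<Phi> y z))\<^sup>2) \<partial>M) \<le> ennreal (\<delta>\<^sup>2)" if "dist x y \<le> r" for x y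
    proof -
      let ?x = "d (i x)" and ?y = "d (i y)"
      have "dist ?x ?y \<le> dist ?x x + dist x y + dist y ?y"
        using dist_triangle[of ?x ?y x] dist_triangle[of x ?y y] by simp
      then have xy: "dist ?x ?y < r + 2" using near[of x] near[of y] that by (simp add: dist_commute)
      have "(\<integral>\<^sup>+z. ennreal ((cmod (\<Phi> x z - \<Phi> y z))\<^sup>2) \<partial>M) = (\<integral>\<^sup>+z. ennreal ((cmod (\<phi> ?x z - \<phi> ?y z))\<^sup>2) \<partial>M)"
      proof (rule nn_integral_cong_AE)
        show "AE z in M. ennreal ((cmod (\<Phi> x z - \<Phi> y z))\<^sup>2) = ennreal ((cmod (\<phi> ?x z - \<phi> ?y z))\<^sup>2)"
          using \<psi>\<phi>[of ?x] \<psi>\<phi>[of ?y] by eventually_elim (simp add: \<Phi>_def)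
      qed
      also have "\<dots> = ennreal ((l2norm M (\<lambda>z. \<phi> ?x z - \<phi> ?y z))\<^sup>2)"
        by (intro nn_integral_l2norm is_L2_diff \<phi>)
      also have "\<dots> \<le> ennreal (\<delta>\<^sup>2)"
        using \<phi>(4)[OF xy] by (intro ennreal_leI power_mono) auto
      finally show ?thesis .
    qed
    \<comment> \<open>Moving \<open>x\<close> by less than \<open>1\<close> enlarges the support
      radius by \<open>1\<close>; the \<open>max\<close> keeps it positive.\<close>
    show "\<Phi> x z = 0" if "max s 0 + 1 < dist x z" for x z
    proof -
      have "s < dist (d (i x)) z"
        using near[of x] that dist_triangle[of x z "d (i x)"] by simp
      then show ?thesis by (simp add: \<Phi>_def \<psi>_def)
    qed
  qed simp
qed

text \<open>\<open>\<Phi> x z * (S f) x\<close> differs from \<open>S (\<Phi> _ z f) x\<close> by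
  \<open>\<integral>y. k x y * (\<Phi> x z - \<Phi> y z) * f y\<close>, which Property A makes small; integrating the squares over
  \<open>z\<close> recovers \<open>l2norm (S f)\<close>, because each \<open>\<Phi> x\<close> is a unit vector.\<close>

lemma localised_bound:
  fixes k :: "'a \<Rightarrow> 'a \<Rightarrow> complex"
  assumes k: "continuous_on UNIV (\<lambda>p. k (fst p) (snd p))" "\<And>x y. cmod (k x y) \<le> B"
      "\<And>x y. r < dist x y \<Longrightarrow> k x y = 0"
    and S: "bounded_op M (Op M k)"
    and V: "\<And>x. emeasure M (cball x r) \<le> ennreal V" "0 \<le> V"
    and \<Phi>: "(\<lambda>p. \<Phi> (fst p) (snd p)) \<in> borel_measurable (M \<Otimes>\<^sub>M M)"
      "\<And>x. (\<integral>\<^sup>+z. ennreal ((cmod (\<Phi> x z))\<^sup>2) \<partial>M) = 1"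
      "\<And>x y. dist x y \<le> r \<Longrightarrow> (\<integral>\<^sup>+z. ennreal ((cmod (\<Phi> x z - \<Phi> y z))\<^sup>2) \<partial>M) \<le> ennreal (\<delta>\<^sup>2)"
    and f: "is_L2 M f"
    and loc: "\<And>z. is_L2 M (\<lambda>y. \<Phi> y z * f y) \<Longrightarrow>
      l2norm M (Op M k (\<lambda>y. \<Phi> y z * f y)) \<le> N * l2norm M (\<lambda>y. \<Phi> y z * f y)"
  shows "(l2norm M (Op M k f))\<^sup>2 \<le> 2 * (N\<^sup>2 + \<delta>\<^sup>2 * (B * V)\<^sup>2) * (l2norm M f)\<^sup>2"
proof -
  interpret sigma_finite_measure M by (rule sigma_finite)
  interpret P: pair_sigma_finite M M ..
  have B: "0 \<le> B" using k(2)[of undefined undefined] norm_ge_zero order_trans by blast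
  note km [measurable (raw)] = continuous_kernel_measurable[OF k(1)]
  note dist_measurable [measurable (raw)]
  have \<Phi>m [measurable (raw)]: "(\<lambda>w. \<Phi> (g w) (h w)) \<in> borel_measurable N'"
    if "g \<in> measurable N' M" "h \<in> measurable N' M" for g h and N' :: "'b measure"
    using measurable_compose[OF measurable_Pair[OF that] \<Phi>(1)] by simp
  have fm [measurable]: "f \<in> borel_measurable M" using f by (simp add: is_L2_def)
  have Sf: "is_L2 M (Op M k f)" using S f by (rule bounded_op_L2)
  then have Sfm [measurable]: "Op M k f \<in> borel_measurable M" by (simp add: is_L2_def)
  \<comment> \<open>Extended nonnegative values allow the three integrations to be exchanged by
    Tonelli.\<close>
  define G where "G = (\<lambda>x y z. ennreal ((cmod (k x y * (\<Phi> x z - \<Phi> y z) * f y))\<^sup>2))"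
  have nf: "(\<integral>\<^sup>+y. ennreal ((cmod (f y))\<^sup>2) \<partial>M) = ennreal ((l2norm M f)\<^sup>2)"
    by (rule nn_integral_l2norm[OF f])
  have split: "(\<integral>\<^sup>+z. \<integral>\<^sup>+x. ennreal ((cmod (\<Phi> x z * g x))\<^sup>2) \<partial>M \<partial>M) = (\<integral>\<^sup>+x. ennreal ((cmod (g x))\<^sup>2) \<partial>M)"
    if [measurable]: "g \<in> borel_measurable M" for g
  proof -
    have "(\<integral>\<^sup>+z. \<integral>\<^sup>+x. ennreal ((cmod (\<Phi> x z * g x))\<^sup>2) \<partial>M \<partial>M) = (\<integral>\<^sup>+x. \<integral>\<^sup>+z. ennreal ((cmod (\<Phi> x z * g x))\<^sup>2) \<partial>M \<partial>M)"
      by (rule P.Fubini') measurable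
    also have "\<dots> = (\<integral>\<^sup>+x. \<integral>\<^sup>+z. ennreal ((cmod (g x))\<^sup>2) * ennreal ((cmod (\<Phi> x z))\<^sup>2) \<partial>M \<partial>M)"
      by (simp add: norm_mult power_mult_distrib ennreal_mult'' mult.commute)
    also have "\<dots> = (\<integral>\<^sup>+x. ennreal ((cmod (g x))\<^sup>2) \<partial>M)"
      by (subst nn_integral_cmult) (measurable, simp add: \<Phi>(2))
    finally show ?thesis .
  qed
  \<comment> \<open>With \<open>z\<close> innermost, Property A contributes
    \<open>\<delta>\<^sup>2\<close> for pairs at distance at most \<open>r\<close>; integrating
    \<open>x\<close> over \<open>cball y r\<close> then contributes \<open>V\<close>.\<close>
  have Gint: "(\<integral>\<^sup>+z. \<integral>\<^sup>+x. \<integral>\<^sup>+y. G x y z \<partial>M \<partial>M \<partial>M) \<le> ennreal (\<delta>\<^sup>2 * B\<^sup>2 * V * (l2norm M f)\<^sup>2)"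
  proof -
    have "(\<integral>\<^sup>+z. \<integral>\<^sup>+x. \<integral>\<^sup>+y. G x y z \<partial>M \<partial>M \<partial>M) = (\<integral>\<^sup>+x. \<integral>\<^sup>+z. \<integral>\<^sup>+y. G x y z \<partial>M \<partial>M \<partial>M)"
      unfolding G_def by (rule P.Fubini') measurable
    also have "\<dots> = (\<integral>\<^sup>+x. \<integral>\<^sup>+y. \<integral>\<^sup>+z. G x y z \<partial>M \<partial>M \<partial>M)"
      unfolding G_def by (intro nn_integral_cong P.Fubini') measurable
    also have "\<dots> \<le> (\<integral>\<^sup>+x. \<integral>\<^sup>+y. ennreal (B\<^sup>2 * \<delta>\<^sup>2 * (cmod (f y))\<^sup>2) * indicator (cball y r) x \<partial>M \<partial>M)"
    proof (intro nn_integral_mono)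
      fix x y
      show "(\<integral>\<^sup>+z. G x y z \<partial>M) \<le> ennreal (B\<^sup>2 * \<delta>\<^sup>2 * (cmod (f y))\<^sup>2) * indicator (cball y r) x"
      proof (cases "dist x y \<le> r")
        case True
        have "(\<integral>\<^sup>+z. G x y z \<partial>M) \<le> (\<integral>\<^sup>+z. ennreal (B\<^sup>2 * (cmod (f y))\<^sup>2) * ennreal ((cmod (\<Phi> x z - \<Phi> y z))\<^sup>2) \<partial>M)"
        proof (rule nn_integral_mono)
          fix z
          have "(cmod (k x y * (\<Phi> x z - \<Phi> y z) * f y))\<^sup>2
              = (cmod (k x y))\<^sup>2 * ((cmod (\<Phi> x z - \<Phi> y z))\<^sup>2 * (cmod (f y))\<^sup>2)"
            by (simp add: norm_mult power_mult_distrib)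
          also have "\<dots> \<le> B\<^sup>2 * ((cmod (\<Phi> x z - \<Phi> y z))\<^sup>2 * (cmod (f y))\<^sup>2)"
            using k(2)[of x y] by (intro mult_right_mono power_mono) auto
          finally have "G x y z \<le> ennreal (B\<^sup>2 * ((cmod (\<Phi> x z - \<Phi> y z))\<^sup>2 * (cmod (f y))\<^sup>2))"
            unfolding G_def by (rule ennreal_leI)
          then show "G x y z \<le> ennreal (B\<^sup>2 * (cmod (f y))\<^sup>2) * ennreal ((cmod (\<Phi> x z - \<Phi> y z))\<^sup>2)"
            by (simp add: mult_ac flip: ennreal_mult'')
        qed
        also have "\<dots> = ennreal (B\<^sup>2 * (cmod (f y))\<^sup>2) * (\<integral>\<^sup>+z. ennreal ((cmod (\<Phi> x z - \<Phi> y z))\<^sup>2) \<partial>M)"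
          by (rule nn_integral_cmult) measurable
        also have "\<dots> \<le> ennreal (B\<^sup>2 * (cmod (f y))\<^sup>2) * ennreal (\<delta>\<^sup>2)"
          by (intro mult_left_mono \<Phi>(3) True) simp
        also have "\<dots> = ennreal (B\<^sup>2 * \<delta>\<^sup>2 * (cmod (f y))\<^sup>2)" by (simp add: mult_ac flip: ennreal_mult'')
        finally show ?thesis using True by (simp add: dist_commute)
      next
        case False
        then show ?thesis using k(3)[of x y] by (simp add: G_def)
      qed
    qed
    also have "\<dots> = (\<integral>\<^sup>+y. \<integral>\<^sup>+x. ennreal (B\<^sup>2 * \<delta>\<^sup>2 * (cmod (f y))\<^sup>2) * indicator (cball y r) x \<partial>M \<partial>M)"
    proof -
      \<comment> \<open>Written through \<open>dist y x\<close>, the indicator is measurable on the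
        product.\<close>
      have "(\<integral>\<^sup>+x. \<integral>\<^sup>+y. ennreal (B\<^sup>2 * \<delta>\<^sup>2 * (cmod (f y))\<^sup>2) * indicator {..r} (dist y x) \<partial>M \<partial>M)
          = (\<integral>\<^sup>+y. \<integral>\<^sup>+x. ennreal (B\<^sup>2 * \<delta>\<^sup>2 * (cmod (f y))\<^sup>2) * indicator {..r} (dist y x) \<partial>M \<partial>M)"
        by (rule P.Fubini'[symmetric]) measurable
      moreover have "(indicator {..r} (dist y x) :: ennreal) = indicator (cball y r) x" for x y :: 'a
        by (simp add: indicator_def)
      ultimately show ?thesis by simp
    qed
    also have "\<dots> \<le> (\<integral>\<^sup>+y. ennreal (B\<^sup>2 * \<delta>\<^sup>2 * V) * ennreal ((cmod (f y))\<^sup>2) \<partial>M)"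
    proof (rule nn_integral_mono)
      fix y
      have "(\<integral>\<^sup>+x. ennreal (B\<^sup>2 * \<delta>\<^sup>2 * (cmod (f y))\<^sup>2) * indicator (cball y r) x \<partial>M)
          = ennreal (B\<^sup>2 * \<delta>\<^sup>2 * (cmod (f y))\<^sup>2) * emeasure M (cball y r)"
        by (rule nn_integral_cmult_indicator) simp
      also have "\<dots> \<le> ennreal (B\<^sup>2 * \<delta>\<^sup>2 * (cmod (f y))\<^sup>2) * ennreal V" by (intro mult_left_mono V) simp
      also have "\<dots> = ennreal (B\<^sup>2 * \<delta>\<^sup>2 * V) * ennreal ((cmod (f y))\<^sup>2)"
        using V(2) by (simp add: mult_ac flip: ennreal_mult'')
      finally show "(\<integral>\<^sup>+x. ennreal (B\<^sup>2 * \<delta>\<^sup>2 * (cmod (f y))\<^sup>2) * indicator (cball y r) x \<partial>M)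
          \<le> ennreal (B\<^sup>2 * \<delta>\<^sup>2 * V) * ennreal ((cmod (f y))\<^sup>2)" .
    qed
    also have "\<dots> = ennreal (\<delta>\<^sup>2 * B\<^sup>2 * V * (l2norm M f)\<^sup>2)"
      using V(2) by (subst nn_integral_cmult) (measurable, simp add: nf mult_ac flip: ennreal_mult'')
    finally show ?thesis .
  qed
  have pointwise: "(\<integral>\<^sup>+x. ennreal ((cmod (\<Phi> x z * Op M k f x))\<^sup>2) \<partial>M)
      \<le> ennreal (2 * N\<^sup>2) * (\<integral>\<^sup>+x. ennreal ((cmod (\<Phi> x z * f x))\<^sup>2) \<partial>M) + ennreal (2 * V) * (\<integral>\<^sup>+x. \<integral>\<^sup>+y. G x y z \<partial>M \<partial>M)"
    if fin: "(\<integral>\<^sup>+x. ennreal ((cmod (\<Phi> x z * f x))\<^sup>2) \<partial>M) < \<infinity>" for z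
  proof -
    define h where "h = (\<lambda>y. \<Phi> y z * f y)"
    have h: "is_L2 M h" using fin unfolding h_def is_L2_iff_nn by (intro conjI) measurable
    have Sh: "is_L2 M (Op M k h)" using S h by (rule bounded_op_L2)
    then have Shm [measurable]: "Op M k h \<in> borel_measurable M" by (simp add: is_L2_def)
    have *: "ennreal ((cmod (\<Phi> x z * Op M k f x))\<^sup>2)
        \<le> 2 * ennreal ((cmod (Op M k h x))\<^sup>2) + ennreal (2 * V) * (\<integral>\<^sup>+y. G x y z \<partial>M)" for x
    proof -
      define u where "u = (\<lambda>y. k x y * (\<Phi> x z - \<Phi> y z) * f y)"
      have kxm [measurable]: "(\<lambda>y. k x y) \<in> borel_measurable M" by measurable
      have kg: "is_L2 M (\<lambda>y. k x y * g y)" if "is_L2 M g" for g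
      proof (rule is_L2_dominated[OF is_L2_cmult[OF that, of "of_real B"]])
        show "(\<lambda>y. k x y * g y) \<in> borel_measurable M"
          using that by (intro borel_measurable_times kxm) (simp add: is_L2_def)
        show "AE y in M. cmod (k x y * g y) \<le> cmod (complex_of_real B * g y)"
          using k(2)[of x] B by (intro AE_I2) (auto simp: norm_mult intro!: mult_right_mono)
      qed
      have one: "is_L2 M (indicator (cball x r))"
      proof (rule is_L2_bounded_support[where B=1 and p=x and R=r])
        show "indicator (cball x r) \<in> borel_measurable borel" by (intro borel_measurable_indicator) simp
      qed (auto simp: indicator_def)
      have onekg: "indicator (cball x r) y * (k x y * c) = k x y * c" for y c
      proof (cases "dist x y \<le> r")
        case False
        then have "k x y = 0" by (intro k(3)) simp
        then show ?thesis by simp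
      qed simp
      have int: "integrable M (\<lambda>y. k x y * g y)" if "is_L2 M g" for g
        using L2_integrable_mult[OF one kg[OF that]] by (simp add: onekg)
      have u_eq: "u y = \<Phi> x z * (k x y * f y) - k x y * h y" for y
        by (simp add: u_def h_def algebra_simps)
      have u: "is_L2 M u" unfolding u_eq[abs_def] by (intro is_L2_diff is_L2_cmult kg f h)
      have D: "\<Phi> x z * Op M k f x - Op M k h x = (\<integral>y. u y \<partial>M)"
        unfolding u_eq Op_def using int f h by simp
      have onu: "indicator (cball x r) y * u y = u y" for y
        using onekg[of y "(\<Phi> x z - \<Phi> y z) * f y"] by (simp only: u_def mult.assoc)
      \<comment> \<open>\<open>u\<close> vanishes off \<open>cball x r\<close>, so Cauchy-Schwarz
        against the indicator gives an \<open>L\<^sup>2\<close> norm at the price of a factor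
        \<open>V\<close> after squaring.\<close>
      have "cmod (\<integral>y. u y \<partial>M) \<le> (\<integral>y. cmod (indicator (cball x r) y * u y) \<partial>M)"
        unfolding onu by (rule integral_norm_bound)
      also have "\<dots> \<le> l2norm M (indicator (cball x r)) * l2norm M u"
        by (rule l2norm_Holder[OF one u])
      finally have "(cmod (\<integral>y. u y \<partial>M))\<^sup>2 \<le> (l2norm M (indicator (cball x r)) * l2norm M u)\<^sup>2"
        by (rule power_mono) simp
      also have "\<dots> = (l2norm M (indicator (cball x r)))\<^sup>2 * (l2norm M u)\<^sup>2" by (rule power_mult_distrib)
      also have "\<dots> \<le> V * (l2norm M u)\<^sup>2"
      proof (rule mult_right_mono)
        have "ennreal ((l2norm M (indicator (cball x r)))\<^sup>2) = (\<integral>\<^sup>+y. indicator (cball x r) y \<partial>M)"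
          unfolding nn_integral_l2norm[OF one, symmetric] by (intro nn_integral_cong) (auto simp: indicator_def)
        also have "\<dots> \<le> ennreal V" using V by simp
        finally show "(l2norm M (indicator (cball x r)))\<^sup>2 \<le> V" using V(2) by simp
      qed simp
      finally have Dle: "(cmod (\<Phi> x z * Op M k f x - Op M k h x))\<^sup>2 \<le> V * (l2norm M u)\<^sup>2"
        by (simp only: D)
      have "(cmod (\<Phi> x z * Op M k f x))\<^sup>2 \<le> (cmod (Op M k h x) + cmod (\<Phi> x z * Op M k f x - Op M k h x))\<^sup>2"
        by (intro power_mono norm_triangle_sub norm_ge_zero)
      \<comment> \<open>\<open>(a + b)\<^sup>2 \<le> 2 * a\<^sup>2 + 2 * b\<^sup>2\<close> is the
        origin of the leading factor \<open>2\<close>.\<close>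
      also have "\<dots> \<le> 2 * (cmod (Op M k h x))\<^sup>2 + 2 * (cmod (\<Phi> x z * Op M k f x - Op M k h x))\<^sup>2"
        using sum_squares_bound[of "cmod (Op M k h x)" "cmod (\<Phi> x z * Op M k f x - Op M k h x)"]
        by (simp add: power2_sum)
      also have "\<dots> \<le> 2 * (cmod (Op M k h x))\<^sup>2 + 2 * V * (l2norm M u)\<^sup>2" using Dle by simp
      finally have "ennreal ((cmod (\<Phi> x z * Op M k f x))\<^sup>2) \<le> ennreal (2 * (cmod (Op M k h x))\<^sup>2 + 2 * V * (l2norm M u)\<^sup>2)"
        by (rule ennreal_leI)
      also have "\<dots> = 2 * ennreal ((cmod (Op M k h x))\<^sup>2) + ennreal (2 * V) * ennreal ((l2norm M u)\<^sup>2)"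
        using V(2) by (simp add: ennreal_mult'')
      also have "ennreal ((l2norm M u)\<^sup>2) = (\<integral>\<^sup>+y. G x y z \<partial>M)"
        unfolding nn_integral_l2norm[OF u, symmetric] by (simp add: G_def u_def)
      finally show ?thesis .
    qed
    have "(\<integral>\<^sup>+x. ennreal ((cmod (\<Phi> x z * Op M k f x))\<^sup>2) \<partial>M)
        \<le> (\<integral>\<^sup>+x. 2 * ennreal ((cmod (Op M k h x))\<^sup>2) + ennreal (2 * V) * (\<integral>\<^sup>+y. G x y z \<partial>M) \<partial>M)"
      by (intro nn_integral_mono *)
    also have "\<dots> = 2 * ennreal ((l2norm M (Op M k h))\<^sup>2) + ennreal (2 * V) * (\<integral>\<^sup>+x. \<integral>\<^sup>+y. G x y z \<partial>M \<partial>M)"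
      unfolding G_def nn_integral_l2norm[OF Sh, symmetric]
      by (subst nn_integral_add, measurable, subst nn_integral_cmult, measurable, subst nn_integral_cmult, measurable)
    also have "2 * ennreal ((l2norm M (Op M k h))\<^sup>2) \<le> 2 * ennreal ((N * l2norm M h)\<^sup>2)"
      using loc[of z] h unfolding h_def by (intro mult_left_mono ennreal_leI power_mono) auto
    also have "2 * ennreal ((N * l2norm M h)\<^sup>2) = ennreal (2 * N\<^sup>2) * (\<integral>\<^sup>+x. ennreal ((cmod (\<Phi> x z * f x))\<^sup>2) \<partial>M)"
      using nn_integral_l2norm[OF h] unfolding h_def by (simp add: power_mult_distrib ennreal_mult'' mult.assoc)
    finally show ?thesis by simp
  qed
  have "ennreal ((l2norm M (Op M k f))\<^sup>2) = (\<integral>\<^sup>+z. \<integral>\<^sup>+x. ennreal ((cmod (\<Phi> x z * Op M k f x))\<^sup>2) \<partial>M \<partial>M)"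
    using nn_integral_l2norm[OF Sf] split[OF Sfm] by simp
  also have "\<dots> \<le> (\<integral>\<^sup>+z. ennreal (2 * N\<^sup>2) * (\<integral>\<^sup>+x. ennreal ((cmod (\<Phi> x z * f x))\<^sup>2) \<partial>M)
      + ennreal (2 * V) * (\<integral>\<^sup>+x. \<integral>\<^sup>+y. G x y z \<partial>M \<partial>M) \<partial>M)"
  proof (rule nn_integral_mono_AE)
    \<comment> \<open>By Tonelli the localised function is square integrable for almost every
      \<open>z\<close>, and for those the pointwise estimate applies.\<close>
    have "AE z in M. (\<integral>\<^sup>+x. ennreal ((cmod (\<Phi> x z * f x))\<^sup>2) \<partial>M) \<noteq> \<infinity>"
    proof (rule nn_integral_PInf_AE)
      show "(\<lambda>z. \<integral>\<^sup>+x. ennreal ((cmod (\<Phi> x z * f x))\<^sup>2) \<partial>M) \<in> borel_measurable M" by measurable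
      show "(\<integral>\<^sup>+z. \<integral>\<^sup>+x. ennreal ((cmod (\<Phi> x z * f x))\<^sup>2) \<partial>M \<partial>M) \<noteq> \<infinity>"
        by (simp add: split[OF fm] nf)
    qed
    then show "AE z in M. (\<integral>\<^sup>+x. ennreal ((cmod (\<Phi> x z * Op M k f x))\<^sup>2) \<partial>M)
      \<le> ennreal (2 * N\<^sup>2) * (\<integral>\<^sup>+x. ennreal ((cmod (\<Phi> x z * f x))\<^sup>2) \<partial>M) + ennreal (2 * V) * (\<integral>\<^sup>+x. \<integral>\<^sup>+y. G x y z \<partial>M \<partial>M)"
      by (rule eventually_mono) (rule pointwise, simp only: infinity_ennreal_def less_top)
  qed
  also have "\<dots> = ennreal (2 * N\<^sup>2) * ennreal ((l2norm M f)\<^sup>2) + ennreal (2 * V) * (\<integral>\<^sup>+z. \<integral>\<^sup>+x. \<integral>\<^sup>+y. G x y z \<partial>M \<partial>M \<partial>M)"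
    unfolding G_def
    by (subst nn_integral_add, measurable, subst nn_integral_cmult, measurable, subst nn_integral_cmult, measurable)
      (simp add: split[OF fm] nf)
  also have "\<dots> \<le> ennreal (2 * N\<^sup>2) * ennreal ((l2norm M f)\<^sup>2) + ennreal (2 * V) * ennreal (\<delta>\<^sup>2 * B\<^sup>2 * V * (l2norm M f)\<^sup>2)"
    by (intro add_mono mult_left_mono Gint) auto
  also have "ennreal (2 * N\<^sup>2) * ennreal ((l2norm M f)\<^sup>2) = ennreal (2 * N\<^sup>2 * (l2norm M f)\<^sup>2)"
    by (rule ennreal_mult''[symmetric]) simp
  also have "ennreal (2 * V) * ennreal (\<delta>\<^sup>2 * B\<^sup>2 * V * (l2norm M f)\<^sup>2)
      = ennreal (2 * V * (\<delta>\<^sup>2 * B\<^sup>2 * V * (l2norm M f)\<^sup>2))"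
    using V(2) by (intro ennreal_mult''[symmetric]) simp
  also have "ennreal (2 * N\<^sup>2 * (l2norm M f)\<^sup>2) + ennreal (2 * V * (\<delta>\<^sup>2 * B\<^sup>2 * V * (l2norm M f)\<^sup>2))
      = ennreal (2 * N\<^sup>2 * (l2norm M f)\<^sup>2 + 2 * V * (\<delta>\<^sup>2 * B\<^sup>2 * V * (l2norm M f)\<^sup>2))"
    using V(2) by (intro ennreal_plus[symmetric]) auto
  \<comment> \<open>The square of \<open>V\<close> collects one factor from Cauchy-Schwarz in
    \<open>y\<close> and one from the volume of the \<open>x\<close>-ball.\<close>
  also have "2 * N\<^sup>2 * (l2norm M f)\<^sup>2 + 2 * V * (\<delta>\<^sup>2 * B\<^sup>2 * V * (l2norm M f)\<^sup>2)
      = 2 * (N\<^sup>2 + \<delta>\<^sup>2 * (B * V)\<^sup>2) * (l2norm M f)\<^sup>2"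
    by (simp add: algebra_simps power2_eq_square)
  finally show ?thesis
    by (subst (asm) ennreal_le_iff) simp_all
qed

section \<open>Smallness of kernel operators at infinity\<close>

lemma l2norm_bounded_support_le:
  assumes u: "u \<in> borel_measurable borel" "\<And>x. cmod (u x) \<le> b" "\<And>x. R < dist p x \<Longrightarrow> u x = 0"
    and V: "emeasure M (cball p R) \<le> ennreal V" "0 \<le> V"
  shows "l2norm M u \<le> b * sqrt V"
proof (rule l2norm_le_nnI)
  show "is_L2 M u" by (rule is_L2_bounded_support[OF u])
  have b: "0 \<le> b" using u(2)[of undefined] norm_ge_zero order_trans by blast
  then show "0 \<le> b * sqrt V" using V by simp
  have "(\<integral>\<^sup>+x. ennreal ((cmod (u x))\<^sup>2) \<partial>M) \<le> (\<integral>\<^sup>+x. ennreal (b\<^sup>2) * indicator (cball p R) x \<partial>M)"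
  proof (rule nn_integral_mono)
    fix x
    have "ennreal ((cmod (u x))\<^sup>2) \<le> ennreal (b\<^sup>2)" using u(2)[of x] by (intro ennreal_leI power_mono) auto
    then show "ennreal ((cmod (u x))\<^sup>2) \<le> ennreal (b\<^sup>2) * indicator (cball p R) x"
      using u(3)[of x] by (cases "dist p x \<le> R") auto
  qed
  also have "\<dots> = ennreal (b\<^sup>2) * emeasure M (cball p R)" by (rule nn_integral_cmult_indicator) simp
  also have "\<dots> \<le> ennreal (b\<^sup>2) * ennreal V" by (intro mult_left_mono V) simp
  also have "\<dots> = ennreal ((b * sqrt V)\<^sup>2)" using V(2) by (simp add: power_mult_distrib ennreal_mult'')
  finally show "(\<integral>\<^sup>+x. ennreal ((cmod (u x))\<^sup>2) \<partial>M) \<le> ennreal ((b * sqrt V)\<^sup>2)" .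
qed

lemma volume_bound:
  obtains V where "0 \<le> V" "\<And>x. emeasure M (cball x r) \<le> ennreal V"
proof -
  obtain C where "\<And>x. emeasure M (cball x r) \<le> ennreal C" using ball_volume by blast
  then have "emeasure M (cball x r) \<le> ennreal (max 0 C)" for x
    by (rule order_trans) (simp add: ennreal_leI)
  then show ?thesis by (intro that[of "max 0 C"]) auto
qed

lemma good_kernelE:
  assumes "good_kernel k"
  obtains B r where "0 \<le> B" "\<And>x y. cmod (k x y) \<le> B" "0 \<le> r" "\<And>x y. r < dist x y \<Longrightarrow> k x y = 0"
    "continuous_on UNIV (\<lambda>p. k (fst p) (snd p))"
proof -
  obtain B r where B: "\<And>x y. cmod (k x y) \<le> B" and r: "\<And>x y. r < dist x y \<Longrightarrow> k x y = 0"
    using assms unfolding good_kernel_def by metis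
  have "0 \<le> B" using B[of undefined undefined] norm_ge_zero order_trans by blast
  moreover have "k x y = 0" if "max r 0 < dist x y" for x y using r that by simp
  moreover have "continuous_on UNIV (\<lambda>p. k (fst p) (snd p))"
    using assms unfolding good_kernel_def by (intro uniformly_continuous_imp_continuous) blast
  ultimately show ?thesis using B that[of B "max r 0"] by auto
qed

text \<open>The localised pieces with \<open>z\<close> in \<open>K\<close> vanish when
  \<open>f\<close> lives far out. For \<open>z\<close> outside \<open>K\<close> the image of a piece
  is supported in \<open>cball z (s + r)\<close> and is compared there with its image under
  \<open>T\<close>: one \<open>e\<close> for the vanishing of \<open>T\<close>, another for the
  distance between the operators. So localisation applies with constant
  \<open>2 * e\<close>.\<close>

lemma controlled_op_small_at_infinity:
  assumes A: "property_A M" and S: "good_kernel k" "bounded_op M (Op M k)" and T: "bounded_op M T"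
    and e: "0 < e" and close: "opnorm M (\<lambda>f x. T f x - Op M k f x) < e"
    and van: "\<And>r. 0 < r \<Longrightarrow> \<exists>K. compact K \<and> (\<forall>x. x \<notin> K \<longrightarrow> opnorm M (\<lambda>f y. indicator (cball x r) y * T f y) < e)"
  obtains R where "\<And>f. is_L2 M f \<Longrightarrow> (\<And>y. dist p y \<le> R \<Longrightarrow> f y = 0) \<Longrightarrow> l2norm M (Op M k f) \<le> 4 * e * l2norm M f"
proof -
  obtain B r where k: "0 \<le> B" "\<And>x y. cmod (k x y) \<le> B" "0 \<le> r" "\<And>x y. r < dist x y \<Longrightarrow> k x y = 0"
    "continuous_on UNIV (\<lambda>p. k (fst p) (snd p))"
    using good_kernelE[OF S(1)] by blast
  obtain V where V: "0 \<le> V" "\<And>x. emeasure M (cball x r) \<le> ennreal V" using volume_bound by blast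
  \<comment> \<open>Makes the commutator error \<open>\<delta> * (B * V)\<close> at most
    \<open>e\<close>; the \<open>+ 1\<close> guards against \<open>B * V = 0\<close>.\<close>
  define \<delta> where "\<delta> = e / (B * V + 1)"
  have BV: "0 \<le> B * V" using k V by simp
  then have \<delta>: "0 < \<delta>" unfolding \<delta>_def using e by (intro divide_pos_pos) auto
  have "\<delta> * (B * V) \<le> \<delta> * (B * V + 1)" using \<delta> by (intro mult_left_mono) auto
  also have "\<dots> = e" using BV by (simp add: \<delta>_def)
  finally have \<delta>e: "\<delta> * (B * V) \<le> e" .
  obtain \<Phi> :: "'a \<Rightarrow> 'a \<Rightarrow> complex" and s where \<Phi>:
    "(\<lambda>p. \<Phi> (fst p) (snd p)) \<in> borel_measurable (M \<Otimes>\<^sub>M M)"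
    "\<And>x. (\<integral>\<^sup>+z. ennreal ((cmod (\<Phi> x z))\<^sup>2) \<partial>M) = 1"
    "\<And>x y. dist x y \<le> r \<Longrightarrow> (\<integral>\<^sup>+z. ennreal ((cmod (\<Phi> x z - \<Phi> y z))\<^sup>2) \<partial>M) \<le> ennreal (\<delta>\<^sup>2)"
    "\<And>x z. s < dist x z \<Longrightarrow> \<Phi> x z = 0" "0 < s"
    using property_A_discretised[OF A \<delta> k(3)] by blast
  obtain K where K: "compact K" "\<And>z. z \<notin> K \<Longrightarrow> opnorm M (\<lambda>f y. indicator (cball z (s + r)) y * T f y) < e"
    using van[of "s + r"] \<Phi>(5) k(3) by auto
  obtain R where R: "\<And>z. z \<in> K \<Longrightarrow> dist p z \<le> R"
    using compact_imp_bounded[OF K(1)] unfolding bounded_any_center[of _ p] by blast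
  \<comment> \<open>For \<open>z\<close> in \<open>K\<close>, every \<open>y\<close> with
    \<open>\<Phi> y z \<noteq> 0\<close> lies within \<open>R + s\<close> of
    \<open>p\<close>.\<close>
  show ?thesis
  proof (rule that[of "R + s"])
    fix f assume f: "is_L2 M f" and f0: "\<And>y. dist p y \<le> R + s \<Longrightarrow> f y = 0"
    have "(l2norm M (Op M k f))\<^sup>2 \<le> 2 * ((2 * e)\<^sup>2 + \<delta>\<^sup>2 * (B * V)\<^sup>2) * (l2norm M f)\<^sup>2"
    proof (rule localised_bound[OF k(5,2,4) S(2) V(2,1) \<Phi>(1,2,3) f])
      fix z
      let ?h = "\<lambda>y. \<Phi> y z * f y"
      assume h: "is_L2 M ?h"
      show "l2norm M (Op M k ?h) \<le> 2 * e * l2norm M ?h"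
      proof (cases "z \<in> K")
        case True
        have h0: "?h y = 0" for y
        proof (cases "dist y z \<le> s")
          case t: True
          then have "dist p y \<le> R + s"
            using R[OF True] dist_triangle[of p y z] by (simp add: dist_commute)
          then show ?thesis using f0 by simp
        qed (use \<Phi>(4) in simp)
        have "Op M k ?h = (\<lambda>x. 0)"
          by (simp only: Op_def h0 mult_zero_right Bochner_Integration.integral_zero)
        then show ?thesis using e by simp
      next
        case False
        let ?i = "indicator (cball z (s + r)) :: 'a \<Rightarrow> complex"
        have im: "?i \<in> borel_measurable M" "\<And>x. cmod (?i x) \<le> 1"
          by (auto simp: indicator_def intro!: borel_measurable_indicator)
        have z: "Op M k ?h x = 0" if "\<not> dist z x \<le> s + r" for x
        proof -
          have "k x y * ?h y = 0" for y
          proof (cases "dist y z \<le> s")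
            case True
            then have "r < dist x y" using that dist_triangle[of z x y] by (simp add: dist_commute)
            then show ?thesis using k(4) by simp
          qed (use \<Phi>(4) in simp)
          then show ?thesis by (simp only: Op_def Bochner_Integration.integral_zero)
        qed
        note Th = bounded_op_L2[OF T h] and Sh = bounded_op_L2[OF S(2) h]
        note iTh = is_L2_mult_le1[OF Th im] and iTS = is_L2_mult_le1[OF is_L2_diff[OF Sh Th] im]
        have "Op M k ?h x = ?i x * T ?h x + ?i x * (Op M k ?h x - T ?h x)" for x
          using z[of x] by (cases "dist z x \<le> s + r") auto
        then have "l2norm M (Op M k ?h) = l2norm M (\<lambda>x. ?i x * T ?h x + ?i x * (Op M k ?h x - T ?h x))"
          by presburger
        also have "\<dots> \<le> l2norm M (\<lambda>x. ?i x * T ?h x) + l2norm M (\<lambda>x. ?i x * (Op M k ?h x - T ?h x))"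
          by (rule l2norm_triangle[OF iTh(1) iTS(1)])
        also have "\<dots> \<le> e * l2norm M ?h + e * l2norm M ?h"
        proof (rule add_mono)
          have "l2norm M (\<lambda>x. ?i x * T ?h x) \<le> opnorm M (\<lambda>f y. ?i y * T f y) * l2norm M ?h"
            by (rule l2norm_le_opnorm[OF bounded_op_mult[OF T im] h])
          also have "\<dots> \<le> e * l2norm M ?h" using K(2)[OF False] by (intro mult_right_mono) auto
          finally show "l2norm M (\<lambda>x. ?i x * T ?h x) \<le> e * l2norm M ?h" .
          have "l2norm M (\<lambda>x. ?i x * (Op M k ?h x - T ?h x)) \<le> l2norm M (\<lambda>x. T ?h x - Op M k ?h x)"
            using iTS(2) by (simp add: l2norm_minus_commute)
          also have "\<dots> \<le> opnorm M (\<lambda>f x. T f x - Op M k f x) * l2norm M ?h"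
            by (rule l2norm_le_opnorm[OF bounded_op_diff[OF T S(2)] h])
          also have "\<dots> \<le> e * l2norm M ?h" using close by (intro mult_right_mono) auto
          finally show "l2norm M (\<lambda>x. ?i x * (Op M k ?h x - T ?h x)) \<le> e * l2norm M ?h" .
        qed
        finally show ?thesis by simp
      qed
    qed
    \<comment> \<open>The sum is at most \<open>2 * (4 + 1) = 10\<close> times
      \<open>e\<^sup>2\<close>, rounded up to the square of \<open>4 * e\<close>.\<close>
    also have "\<dots> \<le> (4 * e * l2norm M f)\<^sup>2"
    proof -
      have "\<delta>\<^sup>2 * (B * V)\<^sup>2 \<le> e\<^sup>2"
        using power_mono[OF \<delta>e, of 2] \<delta> BV by (simp add: power_mult_distrib)
      then have "2 * (4 * e\<^sup>2 + \<delta>\<^sup>2 * (B * V)\<^sup>2) \<le> 2 * (4 * e\<^sup>2 + e\<^sup>2)"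
        by (intro mult_left_mono add_left_mono) auto
      also have "\<dots> \<le> 16 * e\<^sup>2" by simp
      finally have "2 * ((2 * e)\<^sup>2 + \<delta>\<^sup>2 * (B * V)\<^sup>2) \<le> (4 * e)\<^sup>2"
        by (simp add: power_mult_distrib[of _ e])
      then have "2 * ((2 * e)\<^sup>2 + \<delta>\<^sup>2 * (B * V)\<^sup>2) * (l2norm M f)\<^sup>2 \<le> (4 * e)\<^sup>2 * (l2norm M f)\<^sup>2"
        by (rule mult_right_mono) simp
      then show ?thesis by (simp add: power_mult_distrib)
    qed
    finally show "l2norm M (Op M k f) \<le> 4 * e * l2norm M f"
      by (rule power2_le_imp_le) (use e in simp)
  qed
qed

section \<open>Total boundedness on functions of bounded support\<close>

lemma finite_net_complex:
  assumes "0 < e"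
  obtains W :: "complex set" where "finite W" "\<And>c. cmod c \<le> Q \<Longrightarrow> \<exists>w\<in>W. cmod (c - w) < e"
proof -
  obtain W :: "complex set" where "finite W" "cball 0 Q \<subseteq> (\<Union>w\<in>W. ball w e)"
    using compact_cball[of "0 :: complex" Q] assms unfolding compact_eq_totally_bounded by blast
  then show ?thesis by (intro that[of W]) (auto simp: dist_norm norm_minus_commute subset_iff)
qed

text \<open>Uniform continuity allows \<open>y\<close> to be moved to a nearby point of a finite net
  of \<open>cball p R\<close>. The images are then close to combinations of finitely many columns of
  the kernel with bounded coefficients, and a finite net of coefficients suffices.\<close>

lemma controlled_op_totally_bounded:
  assumes k: "good_kernel k" and S: "bounded_op M (Op M k)" and e: "0 < e"
  obtains F where "finite F" "\<And>g. g \<in> F \<Longrightarrow> is_L2 M g"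
    "\<And>f. is_L2 M f \<Longrightarrow> l2norm M f \<le> 1 \<Longrightarrow> (\<And>y. R < dist p y \<Longrightarrow> f y = 0) \<Longrightarrow>
      \<exists>g\<in>F. l2norm M (\<lambda>x. Op M k f x - g x) < e"
proof -
  obtain B r where B: "0 \<le> B" "\<And>x y. cmod (k x y) \<le> B" and r: "0 \<le> r" "\<And>x y. r < dist x y \<Longrightarrow> k x y = 0"
    and cont: "continuous_on UNIV (\<lambda>p. k (fst p) (snd p))"
    using good_kernelE[OF k] by blast
  obtain V0 where V0: "0 \<le> V0" "\<And>x. emeasure M (cball x r) \<le> ennreal V0" using volume_bound by blast
  obtain V1 where V1: "0 \<le> V1" "\<And>x. emeasure M (cball x R) \<le> ennreal V1" using volume_bound by blast
  obtain V2 where V2: "0 \<le> V2" "\<And>x. emeasure M (cball x (R + 1 + r)) \<le> ennreal V2" using volume_bound by blast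
  \<comment> \<open>Bounds the \<open>L\<^sup>1\<close> norm of \<open>f\<close>, by Cauchy-Schwarz
    against the indicator of \<open>cball p R\<close>.\<close>
  define Q where "Q = sqrt V1"
  have Q: "0 \<le> Q" using V1 by (simp add: Q_def)
  have km: "(\<lambda>w. k (g w) (h w)) \<in> borel_measurable N" if "g \<in> measurable N M" "h \<in> measurable N M" for g h and N :: "'b measure"
    by (rule continuous_kernel_measurable[OF cont that])
  \<comment> \<open>A kernel error \<open>\<epsilon>\<close> gives a pointwise error
    \<open>\<epsilon> * Q\<close> on a ball of volume at most \<open>V2\<close>, hence
    \<open>\<epsilon> * Q * sqrt V2\<close> in norm.\<close>
  define \<epsilon> where "\<epsilon> = e / (4 * (1 + Q * sqrt V2))"
  have \<epsilon>: "0 < \<epsilon>" unfolding \<epsilon>_def using e Q V2 by (intro divide_pos_pos mult_pos_pos add_pos_nonneg) auto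
  have \<epsilon>e: "\<epsilon> * Q * sqrt V2 \<le> e / 4"
  proof -
    have "\<epsilon> * (Q * sqrt V2) \<le> \<epsilon> * (1 + Q * sqrt V2)" using \<epsilon> by (intro mult_left_mono) auto
    also have "\<dots> = e / 4"
    proof -
      have "e / (4 * D) * D = e / 4" if "0 < D" for D :: real using that by (simp add: field_simps)
      moreover have "0 < 1 + Q * sqrt V2" using Q V2 by (intro add_pos_nonneg) auto
      ultimately show ?thesis unfolding \<epsilon>_def by blast
    qed
    finally show ?thesis by (simp add: mult.assoc)
  qed
  obtain \<eta>' where \<eta>': "0 < \<eta>'" "\<And>q q'. dist q' q < \<eta>' \<Longrightarrow> dist (k (fst q') (snd q')) (k (fst q) (snd q)) < \<epsilon>"
    using k \<epsilon> unfolding good_kernel_def uniformly_continuous_on_def by (metis UNIV_I)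
  \<comment> \<open>The cap \<open>1\<close> keeps net points within distance \<open>1\<close> of
    the \<open>y\<close> they replace, so that the error vanishes outside radius
    \<open>R + 1 + r\<close>.\<close>
  define \<eta> where "\<eta> = min 1 \<eta>'"
  have \<eta>: "0 < \<eta>" "\<eta> \<le> 1" using \<eta>' by (auto simp: \<eta>_def)
  have kclose: "cmod (k x y - k x y') < \<epsilon>" if "dist y y' < \<eta>" for x y y'
    using \<eta>'(2)[of "(x, y)" "(x, y')"] that by (simp add: \<eta>_def dist_norm dist_Pair_Pair)
  obtain Y where Y: "finite Y" "cball p R \<subseteq> (\<Union>x\<in>Y. ball x \<eta>)"
    using proper[of p R] \<eta>(1) unfolding compact_eq_totally_bounded by blast
  define n where "n = card Y"
  obtain d where d: "bij_betw d {0..<n} Y" using ex_bij_betw_nat_finite[OF Y(1)] unfolding n_def by blast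
  \<comment> \<open>Off \<open>cball p R\<close> no bound on this index is claimed; \<open>f\<close>
    vanishes there.\<close>
  define i where "i = (\<lambda>y. LEAST j. dist y (d j) < \<eta>)"
  have i: "i y < n" "dist y (d (i y)) < \<eta>" if "dist p y \<le> R" for y
  proof -
    have "y \<in> cball p R" using that by simp
    then obtain x where "x \<in> Y" "dist y x < \<eta>" using Y(2) by (auto simp: dist_commute)
    then obtain j where j: "j < n" "dist y (d j) < \<eta>" using d by (auto simp: bij_betw_def)
    show "dist y (d (i y)) < \<eta>" unfolding i_def by (rule LeastI[of _ j]) (rule j)
    have "i y \<le> j" unfolding i_def by (rule Least_le) (rule j)
    then show "i y < n" using j by simp
  qed
  have im: "i \<in> measurable M (count_space UNIV)"
    using measurable_nearby_index[of d \<eta>] by (simp add: i_def)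
  define L where "L = B * sqrt V0"
  have L: "0 \<le> L" using B V0 by (simp add: L_def)
  have kd: "is_L2 M (\<lambda>x. k x c)" "l2norm M (\<lambda>x. k x c) \<le> L" for c
  proof -
    have "(\<lambda>x. k x c) \<in> borel_measurable M" by (rule km; measurable)
    then have m: "(\<lambda>x. k x c) \<in> borel_measurable borel" by simp
    show "is_L2 M (\<lambda>x. k x c)"
      by (rule is_L2_bounded_support[OF m B(2), of r c]) (simp add: r dist_commute)
    show "l2norm M (\<lambda>x. k x c) \<le> L"
      unfolding L_def by (rule l2norm_bounded_support_le[OF m B(2) _ V0(2)[of c] V0(1)]) (simp add: r dist_commute)
  qed
  \<comment> \<open>\<open>n\<close> coefficients, each wrong by at most \<open>\<tau>\<close>
    against functions of norm at most \<open>L\<close>, cost at most \<open>e / 4\<close>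
    altogether.\<close>
  define \<tau> where "\<tau> = e / (4 * (real n + 1) * (L + 1))"
  have \<tau>: "0 < \<tau>" unfolding \<tau>_def using e L by (intro divide_pos_pos mult_pos_pos) auto
  have \<tau>e: "real n * (\<tau> * L) \<le> e / 4"
  proof -
    have "real n * (\<tau> * L) \<le> (real n + 1) * (\<tau> * (L + 1))" using \<tau> L by (intro mult_mono) auto
    also have "\<dots> = e / 4"
    proof -
      have "N * (e / (4 * N * D) * D) = e / 4" if "0 < N" "0 < D" for N D :: real
        using that by (simp add: field_simps)
      from this[of "real n + 1" "L + 1"] L show ?thesis by (simp add: \<tau>_def)
    qed
    finally show ?thesis .
  qed
  obtain W where W: "finite W" "\<And>c. cmod c \<le> Q \<Longrightarrow> \<exists>w\<in>W. cmod (c - w) < \<tau>"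
    using finite_net_complex[OF \<tau>] by metis
  \<comment> \<open>Extensionality outside \<open>{..<n}\<close> makes the set of coefficient
    vectors finite.\<close>
  define F where "F = (\<lambda>w x. \<Sum>j<n. w j * k x (d j)) ` (PiE {..<n} (\<lambda>_. W))"
  show ?thesis
  proof (rule that[of F])
    show "finite F" unfolding F_def using W(1) by (intro finite_imageI finite_PiE) auto
    show "is_L2 M g" if "g \<in> F" for g
      using that unfolding F_def by (auto intro!: is_L2_sum is_L2_cmult kd)
    fix f assume f: "is_L2 M f" "l2norm M f \<le> 1" and f0: "\<And>y. R < dist p y \<Longrightarrow> f y = 0"
    have fm: "f \<in> borel_measurable M" using f(1) by (simp add: is_L2_def)
    let ?A = "indicator (cball p R) :: 'a \<Rightarrow> complex"
    have Am: "?A \<in> borel_measurable borel" by (intro borel_measurable_indicator) simp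
    have AL: "is_L2 M ?A"
      by (rule is_L2_bounded_support[OF Am, of 1 R p]) (auto simp: indicator_def)
    have An: "l2norm M ?A \<le> Q"
      using l2norm_bounded_support_le[OF Am, of 1 R p V1] V1 by (auto simp: indicator_def Q_def)
    have Af: "?A y * f y = f y" for y using f0[of y] by (cases "dist p y \<le> R") auto
    have fint: "integrable M f" using L2_integrable_mult[OF AL f(1)] by (simp only: Af)
    have fQ: "(\<integral>y. cmod (f y) \<partial>M) \<le> Q"
    proof -
      have "(\<integral>y. cmod (f y) \<partial>M) \<le> l2norm M ?A * l2norm M f"
        using l2norm_Holder[OF AL f(1)] by (simp only: Af)
      also have "\<dots> \<le> Q * 1" using An f(2) Q by (intro mult_mono) auto
      finally show ?thesis by simp
    qed
    define c where "c = (\<lambda>j. \<integral>y. indicator {y. i y = j} y * f y \<partial>M)"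
    have im2: "(\<lambda>y. indicator {y. i y = j} y :: complex) \<in> borel_measurable M" for j
    proof (intro borel_measurable_indicator)
      show "{y. i y = j} \<in> sets M"
        using measurable_sets[OF im, of "{j}"] by (simp add: vimage_def)
    qed
    have cint: "integrable M (\<lambda>y. indicator {y. i y = j} y * f y)" for j
    proof (rule Bochner_Integration.integrable_bound[OF fint])
      show "(\<lambda>y. indicator {y. i y = j} y * f y) \<in> borel_measurable M"
        by (rule borel_measurable_times[OF im2 fm])
    qed (auto simp: indicator_def)
    have cQ: "cmod (c j) \<le> Q" for j
    proof -
      have "cmod (c j) \<le> (\<integral>y. cmod (indicator {y. i y = j} y * f y) \<partial>M)"
        unfolding c_def by (rule integral_norm_bound)
      also have "\<dots> \<le> (\<integral>y. cmod (f y) \<partial>M)"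
        by (intro integral_mono integrable_norm cint fint) (auto simp: indicator_def)
      finally show ?thesis using fQ by simp
    qed
    obtain w where w: "\<And>j. w j \<in> W" "\<And>j. cmod (c j - w j) < \<tau>"
      using W(2)[OF cQ] by metis
    let ?g = "\<lambda>x. \<Sum>j<n. c j * k x (d j)"
    let ?h = "\<lambda>x. \<Sum>j<n. w j * k x (d j)"
    have "?h = (\<lambda>x. \<Sum>j<n. restrict w {..<n} j * k x (d j))" by (intro ext sum.cong) auto
    moreover have "restrict w {..<n} \<in> PiE {..<n} (\<lambda>_. W)" using w by auto
    ultimately have hF: "?h \<in> F" unfolding F_def by blast
    have gL: "is_L2 M ?g" and hL: "is_L2 M ?h" by (intro is_L2_sum is_L2_cmult kd)+
    have SL: "is_L2 M (Op M k f)" by (rule bounded_op_L2[OF S f(1)])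
    have kfint: "integrable M (\<lambda>y. k x y * f y)" for x
    proof (rule Bochner_Integration.integrable_bound[OF integrable_mult_right[OF fint, of "of_real B"]])
      have "(\<lambda>y. k x y) \<in> borel_measurable M" by (rule km; measurable)
      then show "(\<lambda>y. k x y * f y) \<in> borel_measurable M" using fm by (rule borel_measurable_times)
    qed (use B in \<open>auto simp: norm_mult intro!: mult_right_mono\<close>)
    have g_eq: "?g x = (\<integral>y. k x (d (i y)) * f y \<partial>M)" and gint: "integrable M (\<lambda>y. k x (d (i y)) * f y)" for x
    proof -
      have eq: "(\<Sum>j<n. k x (d j) * (indicator {y. i y = j} y * f y)) = k x (d (i y)) * f y" for y
      proof (cases "dist p y \<le> R")
        case True
        have "(\<Sum>j<n. k x (d j) * (indicator {y. i y = j} y * f y)) = (\<Sum>j<n. if i y = j then k x (d j) * f y else 0)"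
          by (intro sum.cong) (auto simp: indicator_def)
        then show ?thesis using i(1)[OF True] by simp
      qed (simp add: f0)
      have "integrable M (\<lambda>y. \<Sum>j<n. k x (d j) * (indicator {y. i y = j} y * f y))"
        by (intro Bochner_Integration.integrable_sum integrable_mult_right cint)
      then show "integrable M (\<lambda>y. k x (d (i y)) * f y)" by (simp only: eq)
      have "(\<integral>y. (\<Sum>j<n. k x (d j) * (indicator {y. i y = j} y * f y)) \<partial>M) = (\<Sum>j<n. \<integral>y. k x (d j) * (indicator {y. i y = j} y * f y) \<partial>M)"
        by (intro Bochner_Integration.integral_sum integrable_mult_right cint)
      then show "?g x = (\<integral>y. k x (d (i y)) * f y \<partial>M)"
        unfolding eq by (simp add: c_def mult.commute)
    qed
    have 1: "l2norm M (\<lambda>x. Op M k f x - ?g x) \<le> (\<epsilon> * Q) * sqrt V2"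
    proof (rule l2norm_bounded_support_le[OF _ _ _ V2(2)[of p] V2(1)])
      show "(\<lambda>x. Op M k f x - ?g x) \<in> borel_measurable borel"
        using is_L2_diff[OF SL gL] by (simp add: is_L2_def)
    next
      fix x
      have "cmod (Op M k f x - ?g x) = cmod (\<integral>y. k x y * f y - k x (d (i y)) * f y \<partial>M)"
        unfolding g_eq Op_def using kfint gint by simp
      also have "\<dots> \<le> (\<integral>y. cmod (k x y * f y - k x (d (i y)) * f y) \<partial>M)" by (rule integral_norm_bound)
      also have "\<dots> \<le> (\<integral>y. \<epsilon> * cmod (f y) \<partial>M)"
      proof (rule integral_mono)
        fix y
        show "cmod (k x y * f y - k x (d (i y)) * f y) \<le> \<epsilon> * cmod (f y)"
        proof (cases "dist p y \<le> R")
          case True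
          have "cmod (k x y * f y - k x (d (i y)) * f y) = cmod (k x y - k x (d (i y))) * cmod (f y)"
            by (simp add: norm_mult flip: left_diff_distrib)
          also have "\<dots> \<le> \<epsilon> * cmod (f y)"
            using kclose[OF i(2)[OF True]] by (intro mult_right_mono) (auto intro: less_imp_le)
          finally show ?thesis .
        qed (simp add: f0)
      qed (use kfint gint fint in auto)
      also have "\<dots> \<le> \<epsilon> * Q" using fQ \<epsilon> by simp
      finally show "cmod (Op M k f x - ?g x) \<le> \<epsilon> * Q" .
    next
      fix x assume x: "R + 1 + r < dist p x"
      have eq0: "k x y * f y - k x (d (i y)) * f y = 0" for y
      proof (cases "dist p y \<le> R")
        case True
        have "r < dist x y" using x True dist_triangle[of p x y] by (simp add: dist_commute)
        moreover have "r < dist x (d (i y))"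
          using x True i(2)[OF True] \<eta>(2) dist_triangle[of p x y] dist_triangle[of y x "d (i y)"]
          by (simp add: dist_commute)
        ultimately show ?thesis by (simp add: r)
      qed (simp add: f0)
      have "(\<integral>y. k x y * f y - k x (d (i y)) * f y \<partial>M) = 0"
        by (simp only: eq0 Bochner_Integration.integral_zero)
      then show "Op M k f x - ?g x = 0" unfolding g_eq Op_def using kfint gint by simp
    qed
    have "l2norm M (\<lambda>x. ?g x - ?h x) = l2norm M (\<lambda>x. \<Sum>j<n. (c j - w j) * k x (d j))"
      by (simp add: sum_subtractf left_diff_distrib)
    also have "\<dots> \<le> (\<Sum>j<n. l2norm M (\<lambda>x. (c j - w j) * k x (d j)))"
      by (intro l2norm_sum_le is_L2_cmult kd)
    also have "\<dots> \<le> (\<Sum>j<n. \<tau> * L)"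
      unfolding l2norm_cmult using w(2) kd(2) \<tau> by (intro sum_mono mult_mono) (auto intro: less_imp_le)
    also have "\<dots> \<le> e / 4" using \<tau>e by simp
    finally have 2: "l2norm M (\<lambda>x. ?g x - ?h x) \<le> e / 4" .
    have "l2norm M (\<lambda>x. Op M k f x - ?h x) < e"
      using l2norm_diff_triangle[OF SL gL hL] 1 2 \<epsilon>e e by linarith
    then show "\<exists>g\<in>F. l2norm M (\<lambda>x. Op M k f x - g x) < e" by (rule bexI[OF _ hF])
  qed
qed

text \<open>Functions are cut at the radius \<open>R\<close> beyond which the kernel operator is
  small; a net for the images of the inner parts then serves for \<open>T\<close> on the whole unit
  ball.\<close>

lemma in_G_imp_compact_op:
  assumes A: "property_A M" and G: "in_G M T"
  shows "compact_op M T"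
  unfolding compact_op_def
proof (intro conjI allI impI)
  show T: "bounded_op M T" using G by (simp add: in_G_def in_E_def)
  fix e :: real assume e: "0 < e"
  \<comment> \<open>The outer part of \<open>f\<close> costs \<open>4 * (e / 16)\<close>, the
    passage from \<open>T\<close> to the kernel operator \<open>e / 16\<close> and the net
    \<open>e / 2\<close>: less than \<open>e\<close> in all.\<close>
  then have e16: "0 < e / 16" by simp
  obtain k where k: "good_kernel k" "bounded_op M (Op M k)" "opnorm M (\<lambda>f x. T f x - Op M k f x) < e / 16"
    using G e16 unfolding in_G_def in_E_def by blast
  have van: "\<exists>K. compact K \<and> (\<forall>x. x \<notin> K \<longrightarrow> opnorm M (\<lambda>f y. indicator (cball x r) y * T f y) < e / 16)" if "0 < r" for r
    using G e16 that unfolding in_G_def by blast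
  define p :: 'a where "p = undefined"
  obtain R where R: "\<And>f. is_L2 M f \<Longrightarrow> (\<And>y. dist p y \<le> R \<Longrightarrow> f y = 0) \<Longrightarrow>
      l2norm M (Op M k f) \<le> 4 * (e / 16) * l2norm M f"
    using controlled_op_small_at_infinity[OF A k(1,2) T e16 k(3) van, of p] by blast
  have "0 < e / 2" using e by simp
  then obtain F where F: "finite F" "\<And>g. g \<in> F \<Longrightarrow> is_L2 M g"
    "\<And>f. is_L2 M f \<Longrightarrow> l2norm M f \<le> 1 \<Longrightarrow> (\<And>y. R < dist p y \<Longrightarrow> f y = 0) \<Longrightarrow>
      \<exists>g\<in>F. l2norm M (\<lambda>x. Op M k f x - g x) < e / 2"
    using controlled_op_totally_bounded[OF k(1,2), of "e / 2" R p] by blast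
  show "\<exists>F. finite F \<and> (\<forall>g\<in>F. is_L2 M g) \<and>
      (\<forall>f. is_L2 M f \<and> l2norm M f \<le> 1 \<longrightarrow> (\<exists>g\<in>F. l2norm M (\<lambda>x. T f x - g x) < e))"
  proof (intro exI[of _ F] conjI allI impI ballI)
    fix f assume "is_L2 M f \<and> l2norm M f \<le> 1"
    then have f: "is_L2 M f" "l2norm M f \<le> 1" by auto
    define f1 where "f1 = (\<lambda>y. indicator (cball p R) y * f y)"
    define f2 where "f2 = (\<lambda>y. indicator (- cball p R) y * f y)"
    have m: "(indicator (cball p R) :: 'a \<Rightarrow> complex) \<in> borel_measurable M"
      "(indicator (- cball p R) :: 'a \<Rightarrow> complex) \<in> borel_measurable M"
      by (auto intro!: borel_measurable_indicator)
    have f1: "is_L2 M f1" "l2norm M f1 \<le> 1" "\<And>y. R < dist p y \<Longrightarrow> f1 y = 0"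
      using is_L2_mult_le1[OF f(1) m(1) cmod_indicator_le_1] f(2) by (auto simp: f1_def)
    have f2: "is_L2 M f2" "l2norm M f2 \<le> 1" "\<And>y. dist p y \<le> R \<Longrightarrow> f2 y = 0"
      using is_L2_mult_le1[OF f(1) m(2) cmod_indicator_le_1] f(2) by (auto simp: f2_def)
    obtain g where g: "g \<in> F" "l2norm M (\<lambda>x. Op M k f1 x - g x) < e / 2" using F(3)[OF f1] by blast
    note Tf = bounded_op_L2[OF T f(1)] and Sf = bounded_op_L2[OF k(2) f(1)]
      and Sf1 = bounded_op_L2[OF k(2) f1(1)] and Sf2 = bounded_op_L2[OF k(2) f2(1)]
    have "f = (\<lambda>y. f1 y + 1 * f2 y)" by (auto simp: f1_def f2_def indicator_def fun_eq_iff)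
    then have "AE x in M. Op M k f x - Op M k f1 x = Op M k f2 x"
      using bounded_op_linear_AE[OF k(2) f1(1) f2(1), of 1] by (auto elim: eventually_mono)
    then have "l2norm M (\<lambda>x. Op M k f x - Op M k f1 x) = l2norm M (Op M k f2)"
      using is_L2_diff[OF Sf Sf1] Sf2 by (intro l2norm_cong_AE is_L2_measurable)
    also have "\<dots> \<le> e / 4 * l2norm M f2" using R[OF f2(1,3)] by simp
    also have "\<dots> \<le> e / 4 * 1" using f2(2) e by (intro mult_left_mono) auto
    finally have 1: "l2norm M (\<lambda>x. Op M k f x - Op M k f1 x) \<le> e / 4" by simp
    have "l2norm M (\<lambda>x. T f x - Op M k f x) \<le> opnorm M (\<lambda>f x. T f x - Op M k f x) * l2norm M f"
      by (rule l2norm_le_opnorm[OF bounded_op_diff[OF T k(2)] f(1)])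
    also have "\<dots> \<le> e / 16 * 1" using k(3) f(2) e by (intro mult_mono) auto
    finally have 2: "l2norm M (\<lambda>x. T f x - Op M k f x) \<le> e / 16" by simp
    have "l2norm M (\<lambda>x. T f x - g x) < e"
      using l2norm_diff_triangle[OF Tf Sf F(2)[OF g(1)]] l2norm_diff_triangle[OF Sf Sf1 F(2)[OF g(1)]] 1 2 g(2) e
      by linarith
    then show "\<exists>g\<in>F. l2norm M (\<lambda>x. T f x - g x) < e" using g(1) by blast
  qed (use F in auto)
qed

end

lemma class_A_proper_measure:
  assumes "class_A M"
  shows "proper_measure M"
proof
  show "\<exists>C. \<forall>x. emeasure M (cball x r) \<le> ennreal C" for r
  proof -
    \<comment> \<open>Class A bounds volumes for positive radii only; \<open>max r 1\<close> also
      covers \<open>r \<le> 0\<close>.\<close>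
    have "max r 1 > 0" by simp
    then obtain C where C: "\<And>x. emeasure M (cball x (max r 1)) \<le> ennreal C"
      using assms unfolding class_A_def by blast
    have s: "sets M = sets borel" using assms by (simp add: class_A_def radon_measure_def)
    have "emeasure M (cball x r) \<le> ennreal C" for x
      by (rule order_trans[OF emeasure_mono C[of x]]) (auto simp: s)
    then show ?thesis by blast
  qed
qed (use assms in \<open>auto simp: class_A_def radon_measure_def\<close>)

theorem theorem3p12:
  fixes M :: "'a::metric_space measure"
    and T :: "('a \<Rightarrow> complex) \<Rightarrow> ('a \<Rightarrow> complex)"
  assumes "class_A M"
  shows "compact_op M T \<longleftrightarrow> in_G M T"
proof -
  interpret proper_measure M using assms by (rule class_A_proper_measure)
  have "property_A M" using assms by (simp add: class_A_def)
  then show ?thesis using compact_op_imp_in_G in_G_imp_compact_op by blast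
qed

end
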